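(* Let $0<\alpha<1$, $\gamma>0$, $\delta=\frac{\alpha^{1/2}\gamma^{-1/2}}{1-\alpha}$, $\beta=\frac{1}{1-\alpha}$, and assume that none of $2\delta$, $\beta-\delta$, $\beta+\delta$ is an integer. Let $h_2(x)$ be the second order approximation to the density given in the context. Then as $x\to0^+$, $$h_2(x)\sim\frac{\gamma(1-\alpha)^{-\gamma/(1-\alpha)}}{\Gamma\left(\frac1{1-\alpha}\right)\Gamma\left(1+\frac{\alpha^{1/2}\gamma^{-1/2}}{1-\alpha}\right)\Gamma\left(1-\frac{\alpha^{1/2}\gamma^{-1/2}}{1-\alpha}\right)}\;x^{-1-\gamma/(1-\alpha)}\,e^{-(1-\alpha)^{-\gamma}x^{-\gamma}} .$$
   Context: With $Y=[(1-\alpha)x]^{-\gamma}$, the second order approximation is the function of $x>0$ $$\begin{aligned}h_2(x)=\frac{\gamma x^{-1}}{\Gamma(\beta)\Gamma(1+\delta)\Gamma(1-\delta)}\Bigg\{&\frac{\Gamma(\delta+1-\beta)\Gamma(1-\beta-\delta)}{\Gamma(1-\beta)^2}\,Y^{\beta}\,{}_2F_2\!\left(\beta,\beta;\beta-\delta,\beta+\delta;-Y\right)\\ &+\frac{\Gamma(\beta-1-\delta)\Gamma(-2\delta)}{\Gamma(-\delta)^2}\,Y^{1+\delta}\,{}_2F_2\!\left(1+\delta,1+\delta;2-\beta+\delta,1+2\delta;-Y\right)\\ &+\frac{\Gamma(\beta-1+\delta)\Gamma(2\delta)}{\Gamma(\delta)^2}\,Y^{1-\delta}\,{}_2F_2\!\left(1-\delta,1-\delta;2-\beta-\delta,1-2\delta;-Y\right)\Bigg\},\end{aligned}$$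 where ${}_2F_2(a_1,a_2;b_1,b_2;z)=\sum_{l\ge0}\frac{(a_1)_l(a_2)_l}{(b_1)_l(b_2)_l}\frac{z^l}{l!}$ and $1/\Gamma$ vanishes at the poles of $\Gamma$. Here $f\sim g$ means $f/g\to1$. *)

theory Defs
  imports "HOL-Analysis.Analysis" "HOL-Library.Landau_Symbols"
begin

definition hyp_2F2 :: "real \<Rightarrow> real \<Rightarrow> real \<Rightarrow> real \<Rightarrow> real \<Rightarrow> real" where
  "hyp_2F2 a1 a2 b1 b2 z =
     (\<Sum>l. pochhammer a1 l * pochhammer a2 l / (pochhammer b1 l * pochhammer b2 l)
            * (z ^ l / fact l))"

text \<open>
  The reciprocals \<open>1 / \<Gamma>(1 - \<beta>)\<close>, \<open>1 / \<Gamma>(-\<delta>)\<close> and \<open>1 / \<Gamma>(\<delta>)\<close> are taken to be the entire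
  function \<^const>\<open>rGamma\<close>, which vanishes at the poles of \<^const>\<open>Gamma\<close>. This matters
  for integer \<open>\<beta>\<close>, where the first summand is zero.
\<close>

definition h2 :: "real \<Rightarrow> real \<Rightarrow> real \<Rightarrow> real \<Rightarrow> real \<Rightarrow> real" where
  "h2 \<alpha> \<gamma> \<delta> \<beta> x =
     (let Y = ((1 - \<alpha>) * x) powr (- \<gamma>) in
      \<gamma> * inverse x / (Gamma \<beta> * Gamma (1 + \<delta>) * Gamma (1 - \<delta>)) *
      (Gamma (\<delta> + 1 - \<beta>) * Gamma (1 - \<beta> - \<delta>) * (rGamma (1 - \<beta>))\<^sup>2
         * Y powr \<beta> * hyp_2F2 \<beta> \<beta> (\<beta> - \<delta>) (\<beta> + \<delta>) (- Y)
       + Gamma (\<beta> - 1 - \<delta>) * Gamma (- 2 * \<delta>) * (rGamma (- \<delta>))\<^sup>2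
         * Y powr (1 + \<delta>) * hyp_2F2 (1 + \<delta>) (1 + \<delta>) (2 - \<beta> + \<delta>) (1 + 2 * \<delta>) (- Y)
       + Gamma (\<beta> - 1 + \<delta>) * Gamma (2 * \<delta>) * (rGamma \<delta>)\<^sup>2
         * Y powr (1 - \<delta>) * hyp_2F2 (1 - \<delta>) (1 - \<delta>) (2 - \<beta> - \<delta>) (1 - 2 * \<delta>) (- Y)))"

end

theory Submission
  imports Defs "HOL-Real_Asymp.Real_Asymp"
begin

text \<open>
  With \<open>b = \<beta>\<close> and \<open>d = \<delta>\<close>, the expression in braces is the function \<open>G(Y)\<close> with Mellin transform
  \<open>\<Gamma>(s + b) R(s)\<close>, where \<open>R(s) = \<Gamma>(s+1-d) \<Gamma>(s+1+d) / \<Gamma>(s+1)^2\<close>; without the factor \<open>R\<close> it would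
  be \<open>H(Y) = Y^b exp(-Y)\<close>. Replace \<open>R\<close> by the partial products \<open>R_n\<close> of
  \<open>\<Prod>j\<ge>1. (s+j)^2 / ((s+j)^2 - d^2)\<close>. By partial fractions, \<open>R_n\<close> corresponds to \<open>H\<close> plus a finite
  combination of incomplete gamma functions, that is, to \<open>H(Y)\<close> plus the integral of
  \<open>\<kappa>_n(v) H(Y v) / v\<close> over \<open>v \<ge> 1\<close>. The kernel \<open>\<kappa>_n\<close> is nonnegative, because each factor of
  \<open>R_n\<close> contributes a convolution with a nonnegative function, and the convexity bound
  \<open>H(Y v) \<le> H(Y) v^(b-Y)\<close> yields \<open>H(Y) \<le> G_n(Y) \<le> R_n(Y - b) H(Y)\<close> without any further estimate.
  Expanding the incomplete gamma functions in powers of \<open>Y\<close> and letting \<open>n \<rightarrow> \<infinity>\<close> under the sums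
  (Tannery) gives the three hypergeometric series, so \<open>G\<close> satisfies the same two bounds, and
  \<open>R(Y - b) \<rightarrow> 1\<close>.
\<close>

section \<open>The incomplete gamma function\<close>

text \<open>This is \<open>y powr (- b)\<close> times the lower incomplete gamma function. Without
  the power, a series in \<open>y\<close> remains that is differentiable everywhere.\<close>

definition lower_gamma_series :: "real \<Rightarrow> real \<Rightarrow> real" where
  "lower_gamma_series b y = (\<Sum>l. 1 / (fact l * (b + real l)) * (- y) ^ l)"

text \<open>The continuation of the incomplete gamma integral of \<open>t powr (b - 1) * exp (- t)\<close> over
  \<open>{y..}\<close> to all \<open>b\<close> off the poles of \<^const>\<open>Gamma\<close>, including negative ones.\<close>

definition upper_gamma :: "real \<Rightarrow> real \<Rightarrow> real" where
  "upper_gamma b y = Gamma b - y powr b * lower_gamma_series b y"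

lemma summable_lower_gamma_series:
  fixes b y :: real
  shows "summable (\<lambda>l. 1 / (fact l * (b + real l)) * y ^ l)"
proof (rule summable_comparison_test_ev)
  have "eventually (\<lambda>l. real l > \<bar>b\<bar> + 1) sequentially" by real_asymp
  then show "eventually (\<lambda>l. norm (1 / (fact l * (b + real l)) * y ^ l) \<le> inverse (fact l) * \<bar>y\<bar> ^ l) sequentially"
  proof eventually_elim
    case (elim l)
    then have "b + real l \<ge> 1" by linarith
    then have "inverse (b + real l) \<le> 1" by (simp add: field_simps)
    then have "inverse (fact l) * \<bar>y\<bar> ^ l * inverse (b + real l) \<le> inverse (fact l) * \<bar>y\<bar> ^ l * 1"
      by (intro mult_left_mono) auto
    moreover have "norm (1 / (fact l * (b + real l)) * y ^ l) = inverse (fact l) * \<bar>y\<bar> ^ l * inverse (b + real l)"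
      using \<open>b + real l \<ge> 1\<close> by (simp add: abs_mult power_abs divide_inverse mult_ac)
    ultimately show ?case by simp
  qed
  show "summable (\<lambda>l. inverse (fact l) * \<bar>y\<bar> ^ l)" by (rule summable_exp)
qed

text \<open>After an index shift, \<open>- y * lower_gamma_series (b + 1) y\<close> has the
  coefficients \<open>l / (fact l * (b + l))\<close> in powers of \<open>- y\<close>. Adding
  \<open>b / (fact l * (b + l))\<close> cancels \<open>b + l\<close> and leaves the exponential
  series.\<close>

lemma lower_gamma_series_recurrence:
  assumes "b \<notin> \<int>\<^sub>\<le>\<^sub>0"
  shows "b * lower_gamma_series b y - y * lower_gamma_series (b + 1) y = exp (- y)"
proof -
  have nz: "b + real l \<noteq> 0" for l
  proof
    assume "b + real l = 0"
    then have "b = - of_nat l" by linarith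
    then show False using assms by simp
  qed
  have "(\<lambda>l. 1 / (fact l * (b + real l)) * (- y) ^ l) sums lower_gamma_series b y"
    unfolding lower_gamma_series_def by (rule summable_sums[OF summable_lower_gamma_series])
  then have 1: "(\<lambda>l. b * (1 / (fact l * (b + real l)) * (- y) ^ l)) sums (b * lower_gamma_series b y)"
    by (rule sums_mult)
  have "(\<lambda>l. 1 / (fact l * (b + 1 + real l)) * (- y) ^ l) sums lower_gamma_series (b + 1) y"
    unfolding lower_gamma_series_def by (rule summable_sums[OF summable_lower_gamma_series])
  then have "(\<lambda>l. (- y) * (1 / (fact l * (b + 1 + real l)) * (- y) ^ l)) sums ((- y) * lower_gamma_series (b + 1) y)"
    by (rule sums_mult)
  then have "(\<lambda>l. real (Suc l) / (fact (Suc l) * (b + real (Suc l))) * (- y) ^ Suc l) sums ((- y) * lower_gamma_series (b + 1) y)"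
  proof (rule sums_cong[THEN iffD1, rotated])
    fix l
    have "b + real (Suc l) = b + 1 + real l" by simp
    then show "- y * (1 / (fact l * (b + 1 + real l)) * (- y) ^ l)
        = real (Suc l) / (fact (Suc l) * (b + real (Suc l))) * (- y) ^ Suc l"
      by (simp only: fact_Suc mult.assoc) (simp del: of_nat_Suc)
  qed
  \<comment> \<open>The term at \<open>l = 0\<close> is zero because of its numerator, so the
    shifted series may start at 0.\<close>
  then have 2: "(\<lambda>l. real l / (fact l * (b + real l)) * (- y) ^ l) sums ((- y) * lower_gamma_series (b + 1) y)"
    by (subst (asm) sums_Suc_iff) simp
  have "(\<lambda>l. b * (1 / (fact l * (b + real l)) * (- y) ^ l) + real l / (fact l * (b + real l)) * (- y) ^ l)
      = (\<lambda>l. inverse (fact l) * (- y) ^ l)"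
  proof
    fix l
    have "b * (1 / (fact l * (b + real l)) * (- y) ^ l) + real l / (fact l * (b + real l)) * (- y) ^ l
       = (b + real l) / (b + real l) * (inverse (fact l) * (- y) ^ l)"
      by (simp only: divide_inverse inverse_mult_distrib mult_1) (simp only: algebra_simps mult_1)
    then show "b * (1 / (fact l * (b + real l)) * (- y) ^ l) + real l / (fact l * (b + real l)) * (- y) ^ l
      = inverse (fact l) * (- y) ^ l" using nz[of l] by simp
  qed
  with sums_add[OF 1 2] have "(\<lambda>l. inverse (fact l) * (- y) ^ l) sums (b * lower_gamma_series b y + (- y) * lower_gamma_series (b + 1) y)"
    by simp
  moreover have "(\<lambda>l. inverse (fact l) * (- y) ^ l) sums exp (- y)"
    using exp_converges[of "- y"] by (simp add: divide_inverse mult.commute)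
  ultimately show ?thesis using sums_unique2 by fastforce
qed

lemma has_real_derivative_lower_gamma_series:
  "(lower_gamma_series b has_real_derivative - lower_gamma_series (b + 1) y) (at y)"
proof -
  have "((\<lambda>x. \<Sum>l. 1 / (fact l * (b + real l)) * x ^ l) has_real_derivative
      (\<Sum>l. diffs (\<lambda>l. 1 / (fact l * (b + real l))) l * (- y) ^ l)) (at (- y))"
    by (rule termdiffs_strong_converges_everywhere) (rule summable_lower_gamma_series)
  then have "((\<lambda>x. \<Sum>l. 1 / (fact l * (b + real l)) * (- x) ^ l) has_real_derivative
      (\<Sum>l. diffs (\<lambda>l. 1 / (fact l * (b + real l))) l * (- y) ^ l) * (- 1)) (at y)"
    by (rule DERIV_chain2) (auto intro!: derivative_eq_intros)
  moreover have "diffs (\<lambda>l. 1 / (fact l * (b + real l))) l = 1 / (fact l * (b + 1 + real l))" for l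
  proof -
    have "b + real (Suc l) = b + 1 + real l" by simp
    then show ?thesis by (simp only: diffs_def fact_Suc mult.assoc) (simp del: of_nat_Suc)
  qed
  ultimately show ?thesis
    unfolding lower_gamma_series_def[abs_def] by simp
qed

text \<open>The product rule produces \<open>y powr (b - 1)\<close> times the left side of the
  recurrence. Hence \<open>upper_gamma\<close> differentiates like the tail integral for negative
  \<open>b\<close> too.\<close>

lemma has_real_derivative_upper_gamma:
  assumes "b \<notin> \<int>\<^sub>\<le>\<^sub>0" "y > 0"
  shows "(upper_gamma b has_real_derivative - (y powr (b - 1) * exp (- y))) (at y)"
proof -
  have "(upper_gamma b has_real_derivative
      - (b * y powr (b - 1) * lower_gamma_series b y + - lower_gamma_series (b + 1) y * y powr b)) (at y)"
    unfolding upper_gamma_def[abs_def]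
    using assms by (auto intro!: derivative_eq_intros has_real_derivative_lower_gamma_series)
  moreover have "y powr b = y powr (b - 1) * y"
    using assms by (simp add: powr_diff)
  then have "b * y powr (b - 1) * lower_gamma_series b y + - lower_gamma_series (b + 1) y * y powr b
     = y powr (b - 1) * (b * lower_gamma_series b y - y * lower_gamma_series (b + 1) y)"
    by (simp only: ) (simp add: algebra_simps)
  ultimately show ?thesis by (simp only: lower_gamma_series_recurrence[OF assms(1)])
qed

lemma upper_gamma_plus1:
  assumes "b \<notin> \<int>\<^sub>\<le>\<^sub>0" "y > 0"
  shows "upper_gamma (b + 1) y = b * upper_gamma b y + y powr b * exp (- y)"
proof -
  have "y powr (b + 1) = y powr b * y" using assms by (simp add: powr_add)
  then show ?thesis
    unfolding upper_gamma_def lower_gamma_series_recurrence[OF assms(1), of y, symmetric] Gamma_plus1[OF assms(1)]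
    by (simp only: ) (simp add: algebra_simps)
qed

text \<open>For positive \<open>b\<close>, \<open>Gamma b - upper_gamma b y\<close> is the part of
  Euler's integral over \<open>{0..y}\<close>, which tends to \<open>Gamma b\<close>.\<close>

lemma upper_gamma_tendsto_0_pos:
  assumes b: "b > 0"
  shows "(upper_gamma b \<longlongrightarrow> 0) at_top"
proof -
  define f where "f = (\<lambda>t::real. t powr (b - 1) / exp t)"
  have nn: "b \<notin> \<int>\<^sub>\<le>\<^sub>0" using b by (auto elim!: nonpos_Ints_cases)
  have int: "(f has_integral Gamma b) {0..}"
    unfolding f_def by (rule Gamma_integral_real[OF b])
  have abs: "f absolutely_integrable_on {0..}"
    by (rule nonnegative_absolutely_integrable_1) (use int in \<open>auto simp: f_def has_integral_integrable\<close>)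
  have "((\<lambda>y. set_lebesgue_integral lebesgue {0..y} f) \<longlongrightarrow> set_lebesgue_integral lebesgue {0..} f) at_top"
    by (rule tendsto_set_lebesgue_integral_at_top) (use abs in auto)
  moreover have "set_lebesgue_integral lebesgue {0..} f = Gamma b"
    using set_lebesgue_integral_eq_integral(2)[OF abs] int by (simp add: integral_unique)
  moreover have "set_lebesgue_integral lebesgue {0..y} f = Gamma b - upper_gamma b y" if "y > 0" for y
  proof -
    \<comment> \<open>For \<open>b < 1\<close> the integrand is unbounded at 0, so at this endpoint
      only continuity of the antiderivative is used, which \<open>b > 0\<close> provides.\<close>
    have "(f has_integral ((Gamma b - upper_gamma b y) - (Gamma b - upper_gamma b 0))) {0..y}"
    proof (rule fundamental_theorem_of_calculus_interior)
      show "continuous_on {0..y} (\<lambda>y. Gamma b - upper_gamma b y)"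
        unfolding upper_gamma_def using b
        by (intro continuous_on_diff continuous_on_const continuous_on_mult continuous_on_powr' continuous_on_id
            continuous_at_imp_continuous_on ballI DERIV_isCont[OF has_real_derivative_lower_gamma_series]) auto
      fix x assume "x \<in> {0<..<y}"
      then show "((\<lambda>y. Gamma b - upper_gamma b y) has_vector_derivative f x) (at x)"
        unfolding has_real_derivative_iff_has_vector_derivative[symmetric] f_def
        by (auto intro!: derivative_eq_intros has_real_derivative_upper_gamma[OF nn] simp: exp_minus field_simps)
    qed (use that in auto)
    moreover have "f absolutely_integrable_on {0..y}"
      by (rule set_integrable_subset[OF abs]) auto
    ultimately show ?thesis
      using b by (simp add: set_lebesgue_integral_eq_integral(2) integral_unique upper_gamma_def)
  qed
  ultimately have "((\<lambda>y. Gamma b - upper_gamma b y) \<longlongrightarrow> Gamma b) at_top"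
    by (force elim: Lim_transform_eventually intro: eventually_mono[OF eventually_gt_at_top[of 0]])
  from tendsto_diff[OF tendsto_const[of "Gamma b"] this] show ?thesis by simp
qed

text \<open>For negative \<open>b\<close> the integral diverges at 0. Decay is carried down from
  \<open>b + 1\<close> to \<open>b\<close> by \<open>upper_gamma_plus1\<close>, starting at a
  positive parameter \<open>b + n\<close>.\<close>

lemma upper_gamma_tendsto_0:
  assumes "b \<notin> \<int>\<^sub>\<le>\<^sub>0"
  shows "(upper_gamma b \<longlongrightarrow> 0) at_top"
proof -
  have "(upper_gamma b \<longlongrightarrow> 0) at_top" if "b \<notin> \<int>\<^sub>\<le>\<^sub>0" "b + real n > 0" for n b
    using that
  proof (induction n arbitrary: b)
    case 0
    then show ?case by (simp add: upper_gamma_tendsto_0_pos)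
  next
    case (Suc n)
    have b0: "b \<noteq> 0" using Suc.prems by auto
    have "b + 1 \<notin> \<int>\<^sub>\<le>\<^sub>0" using Suc.prems(1) by (blast dest: plus_one_in_nonpos_Ints_imp)
    then have "(upper_gamma (b + 1) \<longlongrightarrow> 0) at_top" using Suc by simp
    moreover have "((\<lambda>y. y powr b * exp (- y)) \<longlongrightarrow> 0) at_top" by real_asymp
    ultimately have "((\<lambda>y. (upper_gamma (b + 1) y - y powr b * exp (- y)) / b) \<longlongrightarrow> (0 - 0) / b) at_top"
      using b0 by (intro tendsto_intros) auto
    moreover have "eventually (\<lambda>y. (upper_gamma (b + 1) y - y powr b * exp (- y)) / b = upper_gamma b y) at_top"
      using eventually_gt_at_top[of 0] by eventually_elim (use Suc.prems b0 in \<open>simp add: upper_gamma_plus1\<close>)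
    ultimately show ?case by (simp add: tendsto_cong)
  qed
  moreover obtain n where "- b < real n" using reals_Archimedean2 by blast
  then have "b + real n > 0" by simp
  ultimately show ?thesis using assms by blast
qed

section \<open>Partial products of the gamma quotient\<close>

text \<open>\<open>gamma_quot d n s\<close> is a partial product of
  \<open>Gamma (s + 1 - d) * Gamma (s + 1 + d) / Gamma (s + 1)^2\<close>; its poles are at \<open>\<plusminus>d - k\<close> for
  \<open>1 \<le> k \<le> n\<close>, and \<open>gamma_quot_residue (\<plusminus>d) n k\<close> are the residues there.\<close>

definition gamma_quot_factor :: "real \<Rightarrow> real \<Rightarrow> real" where
  "gamma_quot_factor d x = 1 + d\<^sup>2 / (x\<^sup>2 - d\<^sup>2)"

definition gamma_quot :: "real \<Rightarrow> nat \<Rightarrow> real \<Rightarrow> real" where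
  "gamma_quot d n s = (\<Prod>j=1..n. gamma_quot_factor d (s + real j))"

definition gamma_quot_residue :: "real \<Rightarrow> nat \<Rightarrow> nat \<Rightarrow> real" where
  "gamma_quot_residue d n k = d / 2 * (\<Prod>j\<in>{1..n}-{k}. gamma_quot_factor d (real j - real k + d))"

text \<open>The argument of \<open>E\<close> runs over the negatives of the poles. Keeping
  \<open>E\<close> abstract lets the same weights act on \<open>1 / (s + a)\<close>, on
  \<open>v powr - a\<close> and on incomplete gamma functions.\<close>

definition pole_sum :: "real \<Rightarrow> nat \<Rightarrow> (real \<Rightarrow> real) \<Rightarrow> real" where
  "pole_sum d n E = (\<Sum>k=1..n. gamma_quot_residue d n k * E (real k - d)
                              + gamma_quot_residue (- d) n k * E (real k + d))"

lemma gamma_quot_factor_minus [simp]: "gamma_quot_factor (- d) = gamma_quot_factor d"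
  by (simp add: gamma_quot_factor_def fun_eq_iff)

lemma gamma_quot_factor_split:
  assumes "x \<noteq> d" "x \<noteq> - d" "d \<noteq> 0"
  shows "gamma_quot_factor d x = 1 + d / 2 * (1 / (x - d) - 1 / (x + d))"
proof -
  have "x\<^sup>2 - d\<^sup>2 = (x - d) * (x + d)" by (simp add: power2_eq_square algebra_simps)
  moreover have "x - d \<noteq> 0" "x + d \<noteq> 0" using assms by auto
  ultimately show ?thesis by (simp add: gamma_quot_factor_def field_simps power2_eq_square)
qed

section \<open>Linearity and calculus of pole sums\<close>

lemma pole_sum_cong:
  assumes "\<And>k. 1 \<le> k \<Longrightarrow> k \<le> n \<Longrightarrow> E (real k - d) = F (real k - d)"
    and "\<And>k. 1 \<le> k \<Longrightarrow> k \<le> n \<Longrightarrow> E (real k + d) = F (real k + d)"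
  shows "pole_sum d n E = pole_sum d n F"
  unfolding pole_sum_def using assms by (intro sum.cong) auto

lemma pole_sum_add: "pole_sum d n (\<lambda>a. E a + F a) = pole_sum d n E + pole_sum d n F"
  by (simp add: pole_sum_def sum.distrib algebra_simps)

lemma pole_sum_cmult: "pole_sum d n (\<lambda>a. c * E a) = c * pole_sum d n E"
  by (simp add: pole_sum_def sum_distrib_left algebra_simps)

lemma pole_sum_diff: "pole_sum d n (\<lambda>a. E a - F a) = pole_sum d n E - pole_sum d n F"
  by (simp add: pole_sum_def sum_subtractf sum.distrib algebra_simps)

lemma has_real_derivative_pole_sum:
  assumes "\<And>k. 1 \<le> k \<Longrightarrow> k \<le> n \<Longrightarrow> ((\<lambda>x. E x (real k - d)) has_real_derivative E' (real k - d)) (at x)"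
    and "\<And>k. 1 \<le> k \<Longrightarrow> k \<le> n \<Longrightarrow> ((\<lambda>x. E x (real k + d)) has_real_derivative E' (real k + d)) (at x)"
  shows "((\<lambda>x. pole_sum d n (E x)) has_real_derivative pole_sum d n E') (at x)"
  unfolding pole_sum_def
  by (intro DERIV_sum DERIV_add DERIV_cmult) (use assms in auto)

lemma tendsto_pole_sum_zero:
  assumes "\<And>k. 1 \<le> k \<Longrightarrow> k \<le> n \<Longrightarrow> ((\<lambda>x. E x (real k - d)) \<longlongrightarrow> 0) F"
    and "\<And>k. 1 \<le> k \<Longrightarrow> k \<le> n \<Longrightarrow> ((\<lambda>x. E x (real k + d)) \<longlongrightarrow> 0) F"
  shows "((\<lambda>x. pole_sum d n (E x)) \<longlongrightarrow> 0) F"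
  unfolding pole_sum_def
  by (intro tendsto_null_sum tendsto_add_zero tendsto_mult_right_zero) (use assms in auto)

section \<open>Recursion of the residues and partial fractions\<close>

lemma gamma_quot_residue_Suc:
  assumes "k \<le> n"
  shows "gamma_quot_residue d (Suc n) k
           = gamma_quot_residue d n k * gamma_quot_factor d (real (Suc n) - (real k - d))"
proof -
  have "{1..Suc n} - {k} = insert (Suc n) ({1..n} - {k})" using assms by auto
  then show ?thesis by (simp add: gamma_quot_residue_def algebra_simps)
qed

text \<open>The residue at a new pole is a value of the shorter product, so the shorter partial
  fraction expansion determines it.\<close>

lemma gamma_quot_residue_same:
  "gamma_quot_residue d (Suc n) (Suc n) = d / 2 * gamma_quot d n (d - real (Suc n))"
proof -
  have "{1..Suc n} - {Suc n} = {1..n}" by auto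
  then show ?thesis by (simp add: gamma_quot_residue_def gamma_quot_def algebra_simps)
qed

lemma gamma_quot_Suc:
  "gamma_quot d (Suc n) s = gamma_quot d n s * gamma_quot_factor d (s + real (Suc n))"
  by (simp add: gamma_quot_def)

lemma gamma_quot_minus [simp]: "gamma_quot (- d) = gamma_quot d"
  by (simp add: gamma_quot_def fun_eq_iff)

text \<open>A coincidence of a pole \<open>d - k\<close> with a pole \<open>- d - j\<close> would
  make \<open>2 * d\<close> an integer.\<close>

locale simple_poles =
  fixes d :: real
  assumes two_d: "2 * d \<notin> \<int>"
begin

lemma nonzero_d: "d \<noteq> 0" using two_d by auto

lemma two_d_neq: "2 * d \<noteq> real k - real j" "2 * d \<noteq> real k"
  using two_d by (metis Ints_of_nat Ints_diff)+

text \<open>The effect of one more factor of \<^const>\<open>gamma_quot\<close> on its partial fractions, with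
  \<open>1 / (s + a)\<close> replaced by an arbitrary \<open>E a\<close>: the choice \<open>E a = 1 / (s + a)\<close> gives the
  partial fraction expansion itself, \<open>E a = exp (- a x)\<close> its inverse Laplace transform.\<close>

lemma pole_sum_Suc_aux:
  assumes r: "gamma_quot d n (d - real (Suc n)) = 1 + pole_sum d n (\<lambda>a. 1 / (d - real (Suc n) + a))"
    and r': "gamma_quot d n (- d - real (Suc n)) = 1 + pole_sum d n (\<lambda>a. 1 / (- d - real (Suc n) + a))"
  defines "p \<equiv> real (Suc n) - d" and "q \<equiv> real (Suc n) + d"
  shows "pole_sum d (Suc n) E = pole_sum d n E + d / 2 * (E p - E q)
    + d / 2 * pole_sum d n (\<lambda>a. (E a - E p) / (p - a) - (E a - E q) / (q - a))"
proof -
  have ne: "p - (real k - d) \<noteq> 0" "p - (real k + d) \<noteq> 0" "q - (real k - d) \<noteq> 0" "q - (real k + d) \<noteq> 0"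
    if "k \<le> n" for k
    using that two_d_neq(1)[of "Suc n" k] two_d_neq(1)[of k "Suc n"] by (auto simp: p_def q_def)
  have f: "gamma_quot_factor d (real (Suc n) - a) = 1 + d / 2 * (1 / (p - a) - 1 / (q - a))"
    if "p - a \<noteq> 0" "q - a \<noteq> 0" for a
    using that nonzero_d by (subst gamma_quot_factor_split) (auto simp: p_def q_def algebra_simps)
  have neg: "pole_sum d n (\<lambda>a. 1 / (z - real (Suc n) + a)) = - pole_sum d n (\<lambda>a. 1 / (real (Suc n) - z - a))" for z
  proof -
    have "1 / (z - real (Suc n) + a) = (- 1) * (1 / (real (Suc n) - z - a))" for a
    proof -
      have "z - real (Suc n) + a = - (real (Suc n) - z - a)" by simp
      then show ?thesis by (simp only: minus_divide_right[symmetric])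
    qed
    then show ?thesis by (simp only: pole_sum_cmult)
  qed
  have "pole_sum d (Suc n) E = pole_sum d n (\<lambda>a. gamma_quot_factor d (real (Suc n) - a) * E a)
     + gamma_quot_residue d (Suc n) (Suc n) * E p + gamma_quot_residue (- d) (Suc n) (Suc n) * E q"
    unfolding pole_sum_def p_def q_def
    by (simp add: gamma_quot_residue_Suc mult.assoc)
  also have "pole_sum d n (\<lambda>a. gamma_quot_factor d (real (Suc n) - a) * E a)
    = pole_sum d n (\<lambda>a. (1 + d / 2 * (1 / (p - a) - 1 / (q - a))) * E a)"
    by (intro pole_sum_cong) (use ne f in auto)
  \<comment> \<open>\<open>r\<close> and \<open>r'\<close> express the residues at the two new poles
    through the old ones, so everything becomes a pole sum of length \<open>n\<close>.\<close>
  also have "gamma_quot_residue d (Suc n) (Suc n) = d / 2 * (1 - pole_sum d n (\<lambda>a. 1 / (p - a)))"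
    unfolding gamma_quot_residue_same r neg by (simp add: p_def)
  also have "gamma_quot_residue (- d) (Suc n) (Suc n) = - d / 2 * (1 - pole_sum d n (\<lambda>a. 1 / (q - a)))"
    unfolding gamma_quot_residue_same gamma_quot_minus r' neg by (simp add: q_def)
  also have "pole_sum d n (\<lambda>a. (1 + d / 2 * (1 / (p - a) - 1 / (q - a))) * E a)
     + d / 2 * (1 - pole_sum d n (\<lambda>a. 1 / (p - a))) * E p
     + - d / 2 * (1 - pole_sum d n (\<lambda>a. 1 / (q - a))) * E q
     = pole_sum d n (\<lambda>a. (1 + d / 2 * (1 / (p - a) - 1 / (q - a))) * E a
         - d / 2 * E p * (1 / (p - a)) + d / 2 * E q * (1 / (q - a))) + d / 2 * (E p - E q)"
    unfolding pole_sum_add pole_sum_diff pole_sum_cmult by (simp add: algebra_simps) (simp add: field_simps)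
  also have "pole_sum d n (\<lambda>a. (1 + d / 2 * (1 / (p - a) - 1 / (q - a))) * E a
         - d / 2 * E p * (1 / (p - a)) + d / 2 * E q * (1 / (q - a)))
     = pole_sum d n (\<lambda>a. E a + d / 2 * ((E a - E p) / (p - a) - (E a - E q) / (q - a)))"
    by (rule arg_cong[of _ _ "pole_sum d n"]) (simp add: fun_eq_iff diff_divide_distrib algebra_simps)
  finally show ?thesis unfolding pole_sum_add pole_sum_cmult by simp
qed

text \<open>For \<open>E a = 1 / (s + a)\<close> the difference quotient
  \<open>(E a - E p) / (p - a)\<close> equals \<open>E p * E a\<close>, so the recursion in
  \<open>pole_sum_Suc_aux\<close> becomes multiplication by the new factor.\<close>

lemma gamma_quot_partial_fractions:
  assumes "\<And>k. 1 \<le> k \<Longrightarrow> k \<le> n \<Longrightarrow> s + real k \<noteq> d \<and> s + real k \<noteq> - d"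
  shows "gamma_quot d n s = 1 + pole_sum d n (\<lambda>a. 1 / (s + a))"
  using assms
proof (induction n arbitrary: s)
  case 0
  then show ?case by (simp add: gamma_quot_def pole_sum_def)
next
  case (Suc n)
  define p q where "p = real (Suc n) - d" and "q = real (Suc n) + d"
  have ne: "p - (real k - d) \<noteq> 0" "p - (real k + d) \<noteq> 0" "q - (real k - d) \<noteq> 0" "q - (real k + d) \<noteq> 0"
    if "k \<le> n" for k
    using that two_d_neq(1)[of "Suc n" k] two_d_neq(1)[of k "Suc n"] by (auto simp: p_def q_def)
  \<comment> \<open>The induction hypothesis is needed at the two new poles as well as at
    \<open>s\<close>.\<close>
  have r: "gamma_quot d n (d - real (Suc n)) = 1 + pole_sum d n (\<lambda>a. 1 / (d - real (Suc n) + a))"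
    by (rule Suc.IH) (use ne in \<open>force simp: p_def\<close>)
  have r': "gamma_quot d n (- d - real (Suc n)) = 1 + pole_sum d n (\<lambda>a. 1 / (- d - real (Suc n) + a))"
    by (rule Suc.IH) (use ne in \<open>force simp: q_def\<close>)
  have s: "s + real k - d \<noteq> 0" "s + real k + d \<noteq> 0" if "1 \<le> k" "k \<le> Suc n" for k
    using Suc.prems[of k] that by linarith+
  have sp: "s + p \<noteq> 0" "s + q \<noteq> 0" using s[of "Suc n"] by (auto simp: p_def q_def algebra_simps)
  have *: "(1 / (s + a) - 1 / (s + p)) / (p - a) - (1 / (s + a) - 1 / (s + q)) / (q - a)
     = (1 / (s + p) - 1 / (s + q)) * (1 / (s + a))" if "s + a \<noteq> 0" "p - a \<noteq> 0" "q - a \<noteq> 0" for a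
  proof -
    have "(1 / (s + a) - 1 / (s + z)) / (z - a) = 1 / (s + z) * (1 / (s + a))" if "s + z \<noteq> 0" "z - a \<noteq> 0" for z
    proof -
      have "1 / (s + a) - 1 / (s + z) = (z - a) / ((s + a) * (s + z))"
        using that \<open>s + a \<noteq> 0\<close> by (simp add: field_simps)
      then show ?thesis using that by simp
    qed
    from this[OF sp(1) that(2)] this[OF sp(2) that(3)] show ?thesis by (simp only: left_diff_distrib)
  qed
  have "pole_sum d (Suc n) (\<lambda>a. 1 / (s + a)) = pole_sum d n (\<lambda>a. 1 / (s + a)) + d / 2 * (1 / (s + p) - 1 / (s + q))
    + d / 2 * pole_sum d n (\<lambda>a. (1 / (s + p) - 1 / (s + q)) * (1 / (s + a)))"
    unfolding pole_sum_Suc_aux[OF r r'] p_def[symmetric] q_def[symmetric]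
    by (intro arg_cong2[of _ _ _ _ "(+)"] arg_cong2[of _ _ _ _ "(*)"] refl pole_sum_cong *)
       (use s ne in \<open>force simp: add_diff_eq add.assoc\<close>)+
  also have "gamma_quot_factor d (s + real (Suc n)) = 1 + d / 2 * (1 / (s + p) - 1 / (s + q))"
    using Suc.prems[of "Suc n"] nonzero_d by (subst gamma_quot_factor_split) (auto simp: p_def q_def algebra_simps)
  then have "1 + (pole_sum d n (\<lambda>a. 1 / (s + a)) + d / 2 * (1 / (s + p) - 1 / (s + q))
    + d / 2 * pole_sum d n (\<lambda>a. (1 / (s + p) - 1 / (s + q)) * (1 / (s + a)))) = gamma_quot d (Suc n) s"
  proof -
    assume f: "gamma_quot_factor d (s + real (Suc n)) = 1 + d / 2 * (1 / (s + p) - 1 / (s + q))"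
    have IH: "gamma_quot d n s = 1 + pole_sum d n (\<lambda>a. 1 / (s + a))" using Suc by simp
    show ?thesis unfolding pole_sum_cmult gamma_quot_Suc IH f
      by (simp only: distrib_left distrib_right mult_1 mult_1_right) (simp only: mult_ac add_ac)
  qed
  finally show ?case by simp
qed

lemma pole_sum_Suc:
  fixes n E
  defines "p \<equiv> real (Suc n) - d" and "q \<equiv> real (Suc n) + d"
  shows "pole_sum d (Suc n) E = pole_sum d n E + d / 2 * (E p - E q)
    + d / 2 * pole_sum d n (\<lambda>a. (E a - E p) / (p - a) - (E a - E q) / (q - a))"
  unfolding p_def q_def
proof (rule pole_sum_Suc_aux; rule gamma_quot_partial_fractions)
  fix k assume "1 \<le> k" "k \<le> n"
  then show "d - real (Suc n) + real k \<noteq> d \<and> d - real (Suc n) + real k \<noteq> - d"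
    and "- d - real (Suc n) + real k \<noteq> d \<and> - d - real (Suc n) + real k \<noteq> - d"
    using two_d_neq(1)[of "Suc n" k] two_d_neq(1)[of k "Suc n"] by auto
qed

text \<open>Up to a point mass at 0, this is the inverse Laplace transform of
  \<open>gamma_quot d n\<close>. A further factor convolves with a point mass plus
  \<open>d / 2 * (exp (- p * x) - exp (- q * x))\<close>, which is nonnegative because
  \<open>p\<close> is less than \<open>q\<close>.\<close>

lemma pole_sum_exp_nonneg:
  assumes "d > 0" "x \<ge> 0"
  shows "pole_sum d n (\<lambda>a. exp (- a * x)) \<ge> 0"
  using assms(2)
proof (induction n arbitrary: x)
  case 0
  then show ?case by (simp add: pole_sum_def)
next
  case (Suc n)
  define p q where "p = real (Suc n) - d" and "q = real (Suc n) + d"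
  have ne: "p - (real k - d) \<noteq> 0" "p - (real k + d) \<noteq> 0" "q - (real k - d) \<noteq> 0" "q - (real k + d) \<noteq> 0"
    if "k \<le> n" for k
    using that two_d_neq(1)[of "Suc n" k] two_d_neq(1)[of k "Suc n"] by (auto simp: p_def q_def)
  \<comment> \<open>\<open>F\<close> is an antiderivative of the convolution integrand, so up to the
    factor \<open>d / 2\<close> the difference \<open>F x - F 0\<close> is the convolution term of
    \<open>pole_sum_Suc\<close>.\<close>
  define F where "F = (\<lambda>y. pole_sum d n (\<lambda>a. exp (- a * y) * exp (- p * (x - y)) / (p - a)
                           - exp (- a * y) * exp (- q * (x - y)) / (q - a)))"
  have "F 0 \<le> F x"
  proof (rule DERIV_nonneg_imp_nondecreasing[OF Suc.prems])
    fix y assume y: "0 \<le> y" "y \<le> x"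
    have 1: "((\<lambda>y. exp (- a * y) * exp (- p * (x - y)) / (p - a) - exp (- a * y) * exp (- q * (x - y)) / (q - a))
       has_real_derivative (exp (- p * (x - y)) - exp (- q * (x - y))) * exp (- a * y)) (at y)"
      if "p - a \<noteq> 0" "q - a \<noteq> 0" for a
    proof -
      have *: "((\<lambda>y. exp (- a * y) * exp (- z * (x - y)) / (z - a)) has_real_derivative
          exp (- z * (x - y)) * exp (- a * y)) (at y)" if "z - a \<noteq> 0" for z
      proof -
        have "((\<lambda>y. exp (- a * y) * exp (- z * (x - y))) has_real_derivative
            (z - a) * (exp (- z * (x - y)) * exp (- a * y))) (at y)"
          by (auto intro!: derivative_eq_intros simp: algebra_simps)
        from DERIV_cdivide[OF this, of "z - a"] that show ?thesis by simp
      qed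
      show ?thesis unfolding left_diff_distrib by (intro DERIV_diff * that)
    qed
    have "(F has_real_derivative pole_sum d n (\<lambda>a. (exp (- p * (x - y)) - exp (- q * (x - y))) * exp (- a * y))) (at y)"
      unfolding F_def
      by (rule has_real_derivative_pole_sum; rule 1) (use ne in auto)
    moreover have "exp (- p * (x - y)) \<ge> exp (- q * (x - y))"
      using y \<open>d > 0\<close> by (auto simp: p_def q_def intro!: mult_right_mono)
    then have "pole_sum d n (\<lambda>a. (exp (- p * (x - y)) - exp (- q * (x - y))) * exp (- a * y)) \<ge> 0"
      unfolding pole_sum_cmult using Suc.IH[OF y(1)] by (intro mult_nonneg_nonneg) auto
    ultimately show "\<exists>z. (F has_real_derivative z) (at y) \<and> z \<ge> 0" by blast
  qed
  moreover have "F x - F 0 = pole_sum d n (\<lambda>a. (exp (- a * x) - exp (- p * x)) / (p - a)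
                                    - (exp (- a * x) - exp (- q * x)) / (q - a))"
    unfolding F_def pole_sum_diff[symmetric]
    by (rule arg_cong[of _ _ "pole_sum d n"]) (simp add: fun_eq_iff diff_divide_distrib)
  moreover have "exp (- p * x) \<ge> exp (- q * x)"
    using Suc.prems \<open>d > 0\<close> by (auto simp: p_def q_def intro!: mult_right_mono)
  ultimately show ?case
    unfolding pole_sum_Suc p_def[symmetric] q_def[symmetric]
    using Suc.IH[OF Suc.prems] \<open>d > 0\<close> by (intro add_nonneg_nonneg mult_nonneg_nonneg) auto
qed

section \<open>Two-sided bounds for finite \<open>n\<close>\<close>

lemma pole_sum_powr_nonneg:
  assumes "d > 0" "v \<ge> 1"
  shows "pole_sum d n (\<lambda>a. v powr - a) \<ge> 0"
  using pole_sum_exp_nonneg[OF assms(1), of "ln v" n] assms(2) by (simp add: powr_def)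

text \<open>Instead of integrating, the proof uses that a nonincreasing function with limit 0 is
  nonnegative and a nondecreasing one nonpositive. The condition \<open>Y - b > d\<close> makes all
  exponents \<open>Y - b + a\<close> positive, so the comparison tail decays.\<close>

lemma pole_sum_upper_gamma_bounds:
  fixes b Y :: real and n :: nat
  assumes d: "d > 0" and Y: "Y > 0" "Y - b > d" and b: "b - d \<notin> \<int>" "b + d \<notin> \<int>"
  defines "W \<equiv> pole_sum d n (\<lambda>a. Y powr a * upper_gamma (b - a) Y)"
  shows "W \<ge> 0" "W \<le> (gamma_quot d n (Y - b) - 1) * (Y powr b * exp (- Y))"
proof -
  \<comment> \<open>\<open>phi v\<close> stands for the integral of
    \<open>k t * (Y * t) powr b * exp (- (Y * t)) / t\<close> over \<open>{v..}\<close>.\<close>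
  define phi where "phi = (\<lambda>v. pole_sum d n (\<lambda>a. Y powr a * upper_gamma (b - a) (Y * v)))"
  define H where "H = Y powr b * exp (- Y)"
  \<comment> \<open>The subtracted term is the same tail with
    \<open>(Y * t) powr b * exp (- (Y * t))\<close> replaced by its majorant
    \<open>H * t powr (b - Y)\<close>.\<close>
  define psi where "psi = (\<lambda>v. phi v - H * pole_sum d n (\<lambda>a. v powr (- (Y - b + a)) / (Y - b + a)))"
  define k where "k = (\<lambda>v. pole_sum d n (\<lambda>a. v powr - a))"
  have nn: "b - (real k - d) \<notin> \<int>\<^sub>\<le>\<^sub>0" "b - (real k + d) \<notin> \<int>\<^sub>\<le>\<^sub>0" for k
  proof -
    have "b - (real k - d) + real k \<notin> \<int>" "b - (real k + d) + real k \<notin> \<int>" using b by auto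
    then show "b - (real k - d) \<notin> \<int>\<^sub>\<le>\<^sub>0" "b - (real k + d) \<notin> \<int>\<^sub>\<le>\<^sub>0"
      by (metis Ints_add Ints_of_nat nonpos_Ints_Int)+
  qed
  have pos: "Y - b + (real k - d) > 0" "Y - b + (real k + d) > 0" for k
    using Y d by (auto intro: add_pos_nonneg)
  have phi': "(phi has_real_derivative - (Y powr b * v powr (b - 1) * exp (- (Y * v)) * k v)) (at v)" if v: "v > 0" for v
  proof -
    have *: "((\<lambda>v. Y powr a * upper_gamma (b - a) (Y * v)) has_real_derivative
        - (Y powr b * v powr (b - 1) * exp (- (Y * v))) * v powr - a) (at v)" if "b - a \<notin> \<int>\<^sub>\<le>\<^sub>0" for a
    proof -
      have "((\<lambda>v. upper_gamma (b - a) (Y * v)) has_real_derivative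
          - ((Y * v) powr (b - a - 1) * exp (- (Y * v))) * Y) (at v)"
        by (rule DERIV_chain2[OF has_real_derivative_upper_gamma[OF that]])
           (use Y v in \<open>auto intro!: derivative_eq_intros\<close>)
      then have deriv: "((\<lambda>v. Y powr a * upper_gamma (b - a) (Y * v)) has_real_derivative
          Y powr a * (- ((Y * v) powr (b - a - 1) * exp (- (Y * v))) * Y)) (at v)"
        by (rule DERIV_cmult)
      moreover have "Y powr a * Y powr (b - a - 1) * Y = Y powr b"
        using Y by (simp add: powr_add[symmetric] powr_diff powr_mult_base field_simps)
      moreover have "v powr (b - a - 1) = v powr (b - 1) * v powr - a"
        by (simp add: powr_add[symmetric] algebra_simps)
      ultimately have eq: "Y powr a * (- ((Y * v) powr (b - a - 1) * exp (- (Y * v))) * Y)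
          = - (Y powr b * v powr (b - 1) * exp (- (Y * v))) * v powr - a"
        using Y v by (simp add: powr_mult flip: \<open>_ = Y powr b\<close>)
      from deriv show ?thesis unfolding eq .
    qed
    have "(phi has_real_derivative pole_sum d n (\<lambda>a. - (Y powr b * v powr (b - 1) * exp (- (Y * v))) * v powr - a)) (at v)"
      unfolding phi_def by (rule has_real_derivative_pole_sum; rule *; rule nn)
    then show ?thesis unfolding pole_sum_cmult k_def by simp
  qed
  have psi': "(psi has_real_derivative (v powr - 1 * k v) * (H * v powr (- (Y - b)) - (Y * v) powr b * exp (- (Y * v)))) (at v)"
    if v: "v > 0" for v
  proof -
    have *: "((\<lambda>v. v powr (- (Y - b + a)) / (Y - b + a)) has_real_derivative
        - (v powr (- (Y - b)) * v powr - 1) * v powr - a) (at v)" if "Y - b + a > 0" for a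
    proof -
      have "((\<lambda>v. v powr (- (Y - b + a)) / (Y - b + a)) has_real_derivative
        (- (Y - b + a)) * v powr (- (Y - b + a) - 1) / (Y - b + a)) (at v)"
        using v that by (auto intro!: derivative_eq_intros)
      moreover have "(- (Y - b + a)) * v powr (- (Y - b + a) - 1) / (Y - b + a) = - (v powr (- (Y - b + a) - 1))"
        using that by (simp only: minus_divide_left[symmetric] mult_minus_left nonzero_mult_div_cancel_left
            less_imp_neq[symmetric] not_False_eq_True)
      moreover have "v powr (- (Y - b + a) - 1) = v powr (- (Y - b)) * v powr - 1 * v powr - a"
        by (simp only: powr_add[symmetric]) (rule arg_cong[of _ _ "(powr) v"], simp)
      ultimately show ?thesis by simp
    qed
    have "((\<lambda>v. pole_sum d n (\<lambda>a. v powr (- (Y - b + a)) / (Y - b + a))) has_real_derivative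
       pole_sum d n (\<lambda>a. - (v powr (- (Y - b)) * v powr - 1) * v powr - a)) (at v)"
      by (rule has_real_derivative_pole_sum; rule *; rule pos)
    then have "(psi has_real_derivative - (Y powr b * v powr (b - 1) * exp (- (Y * v)) * k v)
       - H * (- (v powr (- (Y - b)) * v powr - 1) * k v)) (at v)"
      unfolding psi_def pole_sum_cmult k_def by (intro DERIV_diff DERIV_cmult phi'[unfolded k_def] v)
    moreover have "v powr (b - 1) = v powr b * v powr - 1" by (simp only: powr_add[symmetric]) simp
    then have "- (Y powr b * v powr (b - 1) * exp (- (Y * v)) * k v)
       - H * (- (v powr (- (Y - b)) * v powr - 1) * k v)
       = (v powr - 1 * k v) * (H * v powr (- (Y - b)) - (Y * v) powr b * exp (- (Y * v)))"
      using Y v by (simp only: powr_mult) (simp only: algebra_simps)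
    ultimately show ?thesis by simp
  qed
  have k: "k v \<ge> 0" if "v \<ge> 1" for v
    unfolding k_def by (rule pole_sum_powr_nonneg[OF d that])
  have phi_lim: "(phi \<longlongrightarrow> 0) at_top"
    unfolding phi_def
  proof (rule tendsto_pole_sum_zero)
    have "filterlim (\<lambda>v. Y * v) at_top at_top" using Y by real_asymp
    then have *: "((\<lambda>v. Y powr a * upper_gamma (b - a) (Y * v)) \<longlongrightarrow> 0) at_top" if "b - a \<notin> \<int>\<^sub>\<le>\<^sub>0" for a
      by (intro tendsto_mult_right_zero filterlim_compose[OF upper_gamma_tendsto_0[OF that]])
    show "((\<lambda>v. Y powr (real k - d) * upper_gamma (b - (real k - d)) (Y * v)) \<longlongrightarrow> 0) at_top"
      and "((\<lambda>v. Y powr (real k + d) * upper_gamma (b - (real k + d)) (Y * v)) \<longlongrightarrow> 0) at_top" for k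
      by (rule *, rule nn)+
  qed
  have psi_lim: "(psi \<longlongrightarrow> 0) at_top"
    unfolding psi_def
  proof (rule tendsto_diff[where a = 0 and b = 0, simplified], rule phi_lim,
      rule tendsto_mult_right_zero, rule tendsto_pole_sum_zero)
    have *: "((\<lambda>v. v powr (- z) / z) \<longlongrightarrow> 0) at_top" if "z > 0" for z :: real
      using that by real_asymp
    show "((\<lambda>v. v powr (- (Y - b + (real k - d))) / (Y - b + (real k - d))) \<longlongrightarrow> 0) at_top"
      and "((\<lambda>v. v powr (- (Y - b + (real k + d))) / (Y - b + (real k + d))) \<longlongrightarrow> 0) at_top" for k
      by (rule *, rule pos)+
  qed
  have "phi 1 \<ge> 0"
  proof (rule tendsto_upperbound[OF phi_lim])
    show "eventually (\<lambda>v. phi v \<le> phi 1) at_top"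
      using eventually_ge_at_top[of 1]
    proof eventually_elim
      case (elim v)
      show ?case
      proof (rule DERIV_nonpos_imp_nonincreasing[OF elim])
        fix x :: real assume "1 \<le> x"
        then show "\<exists>z. (phi has_real_derivative z) (at x) \<and> z \<le> 0"
          using phi'[of x] k[of x] by (intro exI conjI) (auto intro!: mult_nonneg_nonneg)
      qed
    qed
  qed auto
  moreover have W: "W = phi 1" by (simp add: W_def phi_def)
  ultimately show "W \<ge> 0" by simp
  have "psi 1 \<le> 0"
  proof (rule tendsto_lowerbound[OF psi_lim])
    show "eventually (\<lambda>v. psi 1 \<le> psi v) at_top"
      using eventually_ge_at_top[of 1]
    proof eventually_elim
      case (elim v)
      show ?case
      proof (rule DERIV_nonneg_imp_nondecreasing[OF elim])
        fix x :: real assume x: "1 \<le> x" "x \<le> v"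
        \<comment> \<open>The tangent of \<open>ln\<close> at 1 gives the majorant used in
          \<open>psi\<close>, with equality at \<open>x = 1\<close>.\<close>
        have "Y * ln x \<le> Y * (x - 1)" using Y x ln_le_minus_one[of x] by (intro mult_left_mono) auto
        then have "exp (- (Y * x)) \<le> exp (- Y) * x powr - Y"
          using x by (simp add: powr_def exp_add[symmetric] algebra_simps)
        then have "Y powr b * x powr b * exp (- (Y * x)) \<le> Y powr b * x powr b * (exp (- Y) * x powr - Y)"
          by (intro mult_left_mono) auto
        also have "\<dots> = H * x powr (- (Y - b))"
          using x by (simp add: H_def powr_diff powr_minus field_simps)
        finally have "(Y * x) powr b * exp (- (Y * x)) \<le> H * x powr (- (Y - b))"
          using Y x by (simp add: powr_mult)
        then have "(x powr - 1 * k x) * (H * x powr (- (Y - b)) - (Y * x) powr b * exp (- (Y * x))) \<ge> 0"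
          using x k[of x] by (intro mult_nonneg_nonneg) auto
        then show "\<exists>z. (psi has_real_derivative z) (at x) \<and> z \<ge> 0"
          using x psi'[of x] by (intro exI conjI) auto
      qed
    qed
  qed auto
  moreover have "psi 1 = W - H * pole_sum d n (\<lambda>a. 1 / (Y - b + a))"
    by (simp add: psi_def W)
  \<comment> \<open>At \<open>s = Y - b\<close> the partial fractions turn the pole sum in
    \<open>psi 1\<close> into the partial product minus 1.\<close>
  moreover have "gamma_quot d n (Y - b) = 1 + pole_sum d n (\<lambda>a. 1 / (Y - b + a))"
    by (rule gamma_quot_partial_fractions) (use Y d in force)
  ultimately show "W \<le> (gamma_quot d n (Y - b) - 1) * (Y powr b * exp (- Y))"
    by (simp add: H_def algebra_simps)
qed

text \<open>The bound is uniform in \<open>n\<close> and tends to 1 as \<open>c\<close> grows. By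
  \<open>1 + t <= exp t\<close> it reduces to a telescoping sum.\<close>

lemma gamma_quot_le:
  assumes "0 < d" "d < c"
  shows "gamma_quot d n c \<le> exp (d\<^sup>2 / (c - d))"
proof -
  \<comment> \<open>The remainder of the telescoping sum is kept so that the induction
    closes.\<close>
  have "gamma_quot d n c \<le> exp (d\<^sup>2 * (1 / (c - d) - 1 / (c - d + real n)))"
  proof (induction n)
    case 0
    then show ?case by (simp add: gamma_quot_def)
  next
    case (Suc n)
    define x where "x = c - d + real n"
    have x: "x > 0" using assms by (simp add: x_def)
    have eq: "(c + real (Suc n))\<^sup>2 - d\<^sup>2 = (x + 1) * (x + 1 + 2 * d)"
      by (simp add: x_def power2_eq_square algebra_simps)
    have "x * (x + 1) \<le> (x + 1) * (x + 1 + 2 * d)"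
      using x assms by (simp add: mult.commute)
    then have "d\<^sup>2 / ((x + 1) * (x + 1 + 2 * d)) \<le> d\<^sup>2 / (x * (x + 1))"
      using x assms by (intro divide_left_mono) auto
    also have "\<dots> = d\<^sup>2 * (1 / x - 1 / (x + 1))"
      using x by (simp add: field_simps)
    finally have "gamma_quot_factor d (c + real (Suc n)) \<le> 1 + d\<^sup>2 * (1 / x - 1 / (x + 1))"
      unfolding gamma_quot_factor_def eq by simp
    also have "\<dots> \<le> exp (d\<^sup>2 * (1 / x - 1 / (x + 1)))" by (rule exp_ge_add_one_self)
    finally have 1: "gamma_quot_factor d (c + real (Suc n)) \<le> exp (d\<^sup>2 * (1 / x - 1 / (x + 1)))" .
    have "gamma_quot_factor d (c + real (Suc n)) \<ge> 0"
      unfolding gamma_quot_factor_def eq using x assms by (intro add_nonneg_nonneg divide_nonneg_nonneg) auto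
    then have "gamma_quot d (Suc n) c \<le> exp (d\<^sup>2 * (1 / (c - d) - 1 / x)) * exp (d\<^sup>2 * (1 / x - 1 / (x + 1)))"
      unfolding gamma_quot_Suc using Suc 1 by (intro mult_mono) (auto simp: x_def)
    also have "\<dots> = exp (d\<^sup>2 * (1 / (c - d) - 1 / (x + 1)))"
      by (simp add: exp_add[symmetric] algebra_simps)
    finally show ?case by (simp add: x_def add_ac)
  qed
  also have "\<dots> \<le> exp (d\<^sup>2 / (c - d))"
    using assms by (simp add: right_diff_distrib)
  finally show ?thesis .
qed

end

section \<open>Passage to the limit\<close>

lemma pochhammer_diff_nat:
  fixes z :: real
  shows "pochhammer (z - real l) l = (- 1) ^ l * pochhammer (1 - z) l"
  using pochhammer_minus[of "real l - z" l] by simp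

lemma rGamma_diff_nat:
  fixes z :: real
  shows "rGamma (z - real l) = (- 1) ^ l * pochhammer (1 - z) l * rGamma z"
  using pochhammer_rGamma[of "z - real l" l] by (simp add: pochhammer_diff_nat)

text \<open>This inverts the identity for \<open>rGamma\<close>; at poles of the left side both
  sides are 0 by \<open>inverse 0 = 0\<close>.\<close>

lemma Gamma_diff_nat:
  fixes z :: real
  shows "Gamma (z - real l) = (- 1) ^ l / pochhammer (1 - z) l * Gamma z"
  unfolding Gamma_def rGamma_diff_nat by (cases "even l") (simp_all add: field_simps)

lemma gamma_quot_factor_eq:
  assumes "x \<noteq> d" "x \<noteq> - d"
  shows "gamma_quot_factor d x = x\<^sup>2 / ((x - d) * (x + d))"
proof -
  have "x\<^sup>2 - d\<^sup>2 = (x - d) * (x + d)" by (simp add: power2_eq_square algebra_simps)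
  moreover have "x - d \<noteq> 0" "x + d \<noteq> 0" using assms by auto
  then have "(x - d) * (x + d) \<noteq> 0" by simp
  ultimately show ?thesis by (simp add: gamma_quot_factor_def divide_simps)
qed

lemma gamma_quot_pochhammer:
  assumes "\<And>j. s + 1 + real j \<noteq> d \<and> s + 1 + real j \<noteq> - d"
  shows "gamma_quot d n s = (pochhammer (s + 1) n)\<^sup>2 / (pochhammer (s + 1 - d) n * pochhammer (s + 1 + d) n)"
proof (induction n)
  case 0
  then show ?case by (simp add: gamma_quot_def)
next
  case (Suc n)
  have "gamma_quot_factor d (s + real (Suc n)) = (s + 1 + real n)\<^sup>2 / ((s + 1 - d + real n) * (s + 1 + d + real n))"
    using assms[of n] by (subst gamma_quot_factor_eq) (auto simp: algebra_simps)
  then show ?case unfolding gamma_quot_Suc Suc pochhammer_Suc by (simp add: power_mult_distrib)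
qed

text \<open>Euler's limit formula is applied to each gamma factor. The powers of \<open>n\<close>
  cancel because \<open>s + 1 - d\<close> and \<open>s + 1 + d\<close> add up to twice
  \<open>s + 1\<close>. Euler's product of index \<open>n\<close> has \<open>Suc n\<close> factors,
  hence the shift.\<close>

lemma gamma_quot_LIMSEQ:
  assumes "s + 1 - d \<notin> \<int>\<^sub>\<le>\<^sub>0" "s + 1 + d \<notin> \<int>\<^sub>\<le>\<^sub>0"
  shows "(\<lambda>n. gamma_quot d n s) \<longlonglongrightarrow> (rGamma (s + 1))\<^sup>2 * Gamma (s + 1 - d) * Gamma (s + 1 + d)"
proof -
  have ne: "s + 1 + real j \<noteq> d \<and> s + 1 + real j \<noteq> - d" for j
  proof -
    have "s + 1 - d \<noteq> - real j" "s + 1 + d \<noteq> - real j"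
      using assms by (metis minus_of_nat_in_nonpos_Ints)+
    then show ?thesis by linarith
  qed
  have "gamma_quot d (Suc n) s = (rGamma_series (s + 1) n)\<^sup>2 * Gamma_series (s + 1 - d) n * Gamma_series (s + 1 + d) n" for n
  proof -
    define e where "e = (\<lambda>z. exp (z * ln (real n)))"
    have e: "(e (s + 1))\<^sup>2 = e (s + 1 - d) * e (s + 1 + d)" and ee: "e z \<noteq> 0" for z
      by (simp_all add: e_def power2_eq_square exp_add[symmetric] algebra_simps)
    have series: "rGamma_series z n = pochhammer z (Suc n) / (fact n * e z)"
      "Gamma_series z n = fact n * e z / pochhammer z (Suc n)" for z
      by (simp_all add: rGamma_series_def Gamma_series_def e_def)
    have "(rGamma_series (s + 1) n)\<^sup>2 * Gamma_series (s + 1 - d) n * Gamma_series (s + 1 + d) n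
      = (pochhammer (s + 1) (Suc n))\<^sup>2 * ((fact n)\<^sup>2 * (e (s + 1 - d) * e (s + 1 + d))) /
         (((fact n)\<^sup>2 * (e (s + 1))\<^sup>2) * (pochhammer (s + 1 - d) (Suc n) * pochhammer (s + 1 + d) (Suc n)))"
      unfolding series power_divide power_mult_distrib by (simp add: power2_eq_square mult_ac)
    then show ?thesis
      unfolding gamma_quot_pochhammer[OF ne] e[symmetric] using ee[of "s + 1"] by simp
  qed
  moreover have "(\<lambda>n. (rGamma_series (s + 1) n)\<^sup>2 * Gamma_series (s + 1 - d) n * Gamma_series (s + 1 + d) n)
     \<longlonglongrightarrow> (rGamma (s + 1))\<^sup>2 * Gamma (s + 1 - d) * Gamma (s + 1 + d)"
    by (intro tendsto_intros)
  ultimately have "(\<lambda>n. gamma_quot d (Suc n) s) \<longlonglongrightarrow> (rGamma (s + 1))\<^sup>2 * Gamma (s + 1 - d) * Gamma (s + 1 + d)"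
    by simp
  then show ?thesis by (rule LIMSEQ_imp_Suc)
qed

text \<open>Each factor is at most \<open>exp (t m)\<close> in absolute value, and \<open>t\<close>
  is summable over the integers. Arbitrary finite sets cover shifted windows and windows with one
  index removed.\<close>

lemma prod_gamma_quot_factor_bounded:
  obtains C where "C > 0" and "\<And>F :: int set. finite F \<Longrightarrow> \<bar>\<Prod>m\<in>F. gamma_quot_factor d (x + of_int m)\<bar> \<le> C"
proof -
  define t where "t = (\<lambda>m::int. \<bar>d\<^sup>2 / ((x + of_int m)\<^sup>2 - d\<^sup>2)\<bar>)"
  have s: "summable (\<lambda>i. 1 / real i ^ 2)" by (simp add: inverse_power_summable divide_inverse)
  have 1: "summable (\<lambda>i. t (int i))"
  proof (rule summable_comparison_test_bigo)
    show "(\<lambda>i. t (int i)) \<in> O(\<lambda>i. 1 / real i ^ 2)" unfolding t_def of_int_of_nat_eq by (simp, real_asymp)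
  qed (use s in simp)
  have 2: "summable (\<lambda>i. t (- int i))"
  proof (rule summable_comparison_test_bigo)
    show "(\<lambda>i. t (- int i)) \<in> O(\<lambda>i. 1 / real i ^ 2)" unfolding t_def of_int_minus of_int_of_nat_eq by (simp, real_asymp)
  qed (use s in simp)
  \<comment> \<open>Index 0 occurs in both series; counting it twice only enlarges the
    bound.\<close>
  define S where "S = (\<Sum>i. t (int i)) + (\<Sum>i. t (- int i))"
  have "\<bar>\<Prod>m\<in>F. gamma_quot_factor d (x + of_int m)\<bar> \<le> exp S" if F: "finite F" for F :: "int set"
  proof -
    have t0: "t m \<ge> 0" for m by (simp add: t_def)
    obtain M where M: "\<And>m. m \<in> F \<Longrightarrow> nat \<bar>m\<bar> \<le> M"
      using F finite_imageI[OF F, of "\<lambda>m. nat \<bar>m\<bar>"] finite_nat_set_iff_bounded_le by (metis imageI)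
    have sub: "F \<subseteq> int ` {..M} \<union> (\<lambda>i. - int i) ` {..M}"
    proof
      fix m assume "m \<in> F"
      then have "nat \<bar>m\<bar> \<in> {..M}" using M by simp
      moreover have "m = int (nat \<bar>m\<bar>) \<or> m = - int (nat \<bar>m\<bar>)" by auto
      ultimately show "m \<in> int ` {..M} \<union> (\<lambda>i. - int i) ` {..M}" by (metis UnI1 UnI2 imageI)
    qed
    have "sum t F \<le> sum t (int ` {..M} \<union> (\<lambda>i. - int i) ` {..M})"
      using sub t0 by (intro sum_mono2) auto
    also have "\<dots> \<le> sum t (int ` {..M}) + sum t ((\<lambda>i. - int i) ` {..M})"
      using t0 by (subst sum_Un) (auto intro!: sum_nonneg)
    also have "sum t (int ` {..M}) = (\<Sum>i\<le>M. t (int i))" by (simp add: sum.reindex)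
    also have "sum t ((\<lambda>i. - int i) ` {..M}) = (\<Sum>i\<le>M. t (- int i))" by (subst sum.reindex) (auto simp: inj_on_def)
    also have "(\<Sum>i\<le>M. t (int i)) + (\<Sum>i\<le>M. t (- int i)) \<le> S"
      unfolding S_def using 1 2 t0 by (intro add_mono sum_le_suminf) auto
    finally have S: "sum t F \<le> S" .
    have "\<bar>\<Prod>m\<in>F. gamma_quot_factor d (x + of_int m)\<bar> = (\<Prod>m\<in>F. \<bar>gamma_quot_factor d (x + of_int m)\<bar>)"
      by (rule abs_prod)
    also have "\<dots> \<le> (\<Prod>m\<in>F. exp (t m))"
    proof (rule prod_mono)
      fix m
      have "\<bar>gamma_quot_factor d (x + of_int m)\<bar> \<le> 1 + t m"
        unfolding gamma_quot_factor_def t_def by (rule order_trans[OF abs_triangle_ineq]) simp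
      also have "\<dots> \<le> exp (t m)" by (rule exp_ge_add_one_self)
      finally show "0 \<le> \<bar>gamma_quot_factor d (x + of_int m)\<bar> \<and> \<bar>gamma_quot_factor d (x + of_int m)\<bar> \<le> exp (t m)" by simp
    qed
    also have "\<dots> = exp (sum t F)" by (simp add: exp_sum F)
    finally show ?thesis using S by (meson exp_le_cancel_iff order_trans)
  qed
  with that[of "exp S"] show ?thesis by simp
qed

lemma gamma_quot_bounded:
  obtains C where "C > 0" and "\<And>n l. \<bar>gamma_quot d n (s - real l)\<bar> \<le> C"
proof -
  obtain C where C: "C > 0" "\<And>F :: int set. finite F \<Longrightarrow> \<bar>\<Prod>m\<in>F. gamma_quot_factor d (s + of_int m)\<bar> \<le> C"
    by (rule prod_gamma_quot_factor_bounded[where d = d and x = s]) blast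
  have "gamma_quot d n (s - real l) = (\<Prod>m\<in>(\<lambda>j. int j - int l) ` {1..n}. gamma_quot_factor d (s + of_int m))" for n l
    unfolding gamma_quot_def by (subst prod.reindex) (auto simp: inj_on_def algebra_simps)
  with C that show ?thesis by (metis finite_imageI finite_atLeastAtMost)
qed

text \<open>Removing \<open>k\<close> removes exactly the offset 0 from the window, where the factor
  would be singular. The constant serves as a majorant in Tannery's theorem.\<close>

lemma gamma_quot_residue_bounded:
  obtains C where "C > 0" and "\<And>n k. \<bar>gamma_quot_residue d n k\<bar> \<le> C"
proof -
  obtain C where C: "C > 0" "\<And>F :: int set. finite F \<Longrightarrow> \<bar>\<Prod>m\<in>F. gamma_quot_factor d (d + of_int m)\<bar> \<le> C"
    by (rule prod_gamma_quot_factor_bounded[where d = d and x = d]) blast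
  have "\<bar>gamma_quot_residue d n k\<bar> \<le> (\<bar>d\<bar> / 2 + 1) * C" for n k
  proof -
    have "(\<Prod>j\<in>{1..n}-{k}. gamma_quot_factor d (real j - real k + d))
       = (\<Prod>m\<in>(\<lambda>j. int j - int k) ` ({1..n}-{k}). gamma_quot_factor d (d + of_int m))"
      by (subst prod.reindex) (auto simp: inj_on_def algebra_simps)
    then have "\<bar>\<Prod>j\<in>{1..n}-{k}. gamma_quot_factor d (real j - real k + d)\<bar> \<le> C" using C(2) by simp
    then show ?thesis unfolding gamma_quot_residue_def abs_mult using C(1) by (intro mult_mono) auto
  qed
  moreover have "(\<bar>d\<bar> / 2 + 1) * C > 0" using C(1) by (intro mult_pos_pos) auto
  ultimately show ?thesis using that by blast
qed

section \<open>Limits of the residues\<close>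

context simple_poles
begin

lemma minus_simple_poles: "simple_poles (- d)"
  using two_d by unfold_locales (metis Ints_minus mult_minus_right minus_minus)

lemma d_notin_Ints: "d \<notin> \<int>"
  using two_d by (metis Ints_add mult_2)

text \<open>The product splits at the removed index. The \<open>l\<close> factors below it give the
  pochhammer quotient; those above form a partial product at \<open>s = d\<close>, whose limit is
  \<open>2 / d * Gamma (2 * d) * (rGamma d)^2\<close>.\<close>

lemma gamma_quot_residue_LIMSEQ:
  "(\<lambda>n. gamma_quot_residue d n (Suc l)) \<longlonglongrightarrow>
     Gamma (2 * d) * (rGamma d)\<^sup>2 * ((pochhammer (1 - d) l)\<^sup>2 / (fact l * pochhammer (1 - 2 * d) l))"
proof -
  have d: "d \<noteq> real k" "d \<noteq> - real k" for k
    using d_notin_Ints by (metis Ints_of_nat Ints_minus)+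
  have head: "(\<Prod>j=1..l. gamma_quot_factor d (real j - real (Suc l) + d))
      = (pochhammer (1 - d) l)\<^sup>2 / (fact l * pochhammer (1 - 2 * d) l)"
  proof -
    have "(\<Prod>j=1..l. gamma_quot_factor d (real j - real (Suc l) + d)) = (\<Prod>j<l. gamma_quot_factor d (d - 1 - real j))"
      by (rule prod.reindex_bij_witness[of _ "\<lambda>j. l - j" "\<lambda>j. l - j"]) (auto simp: of_nat_diff algebra_simps)
    also have "\<dots> = (pochhammer (1 - d) l)\<^sup>2 / (fact l * pochhammer (1 - 2 * d) l)"
    proof (induction l)
      case (Suc l)
      have "gamma_quot_factor d (d - 1 - real l) = (1 - d + real l)\<^sup>2 / ((real l + 1) * (1 - 2 * d + real l))"
      proof (subst gamma_quot_factor_eq)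
        show "d - 1 - real l \<noteq> d" by simp
        show "d - 1 - real l \<noteq> - d" using two_d_neq(2)[of "Suc l"] by auto
        have "(d - 1 - real l)\<^sup>2 = (1 - d + real l)\<^sup>2"
          "(d - 1 - real l - d) * (d - 1 - real l + d) = (real l + 1) * (1 - 2 * d + real l)"
          by (simp_all add: power2_eq_square algebra_simps)
        then show "(d - 1 - real l)\<^sup>2 / ((d - 1 - real l - d) * (d - 1 - real l + d)) =
           (1 - d + real l)\<^sup>2 / ((real l + 1) * (1 - 2 * d + real l))" by simp
      qed
      then show ?case unfolding prod.lessThan_Suc Suc pochhammer_Suc by (simp add: power_mult_distrib mult_ac add_ac)
    qed simp
    finally show ?thesis .
  qed
  have split: "gamma_quot_residue d (n + Suc l) (Suc l)
     = d / 2 * ((pochhammer (1 - d) l)\<^sup>2 / (fact l * pochhammer (1 - 2 * d) l) * gamma_quot d n d)" for n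
  proof -
    have "{1..n + Suc l} - {Suc l} = {1..l} \<union> {Suc (Suc l)..n + Suc l}" by auto
    then have "(\<Prod>j\<in>{1..n + Suc l} - {Suc l}. gamma_quot_factor d (real j - real (Suc l) + d))
      = (\<Prod>j=1..l. gamma_quot_factor d (real j - real (Suc l) + d))
        * (\<Prod>j=Suc (Suc l)..n + Suc l. gamma_quot_factor d (real j - real (Suc l) + d))"
      by (simp only:) (rule prod.union_disjoint; auto)
    also have "(\<Prod>j=Suc (Suc l)..n + Suc l. gamma_quot_factor d (real j - real (Suc l) + d)) = gamma_quot d n d"
      unfolding gamma_quot_def
      by (rule prod.reindex_bij_witness[of _ "\<lambda>j. j + Suc l" "\<lambda>j. j - Suc l"]) (auto simp: of_nat_diff algebra_simps)
    finally show ?thesis unfolding gamma_quot_residue_def head by simp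
  qed
  have "(\<lambda>n. gamma_quot d n d) \<longlonglongrightarrow> (rGamma (d + 1))\<^sup>2 * Gamma (d + 1 - d) * Gamma (d + 1 + d)"
  proof (rule gamma_quot_LIMSEQ)
    show "d + 1 + d \<notin> \<int>\<^sub>\<le>\<^sub>0" using two_d by (metis Ints_1 Ints_diff add.commute add.left_commute add_diff_cancel_left' mult_2 nonpos_Ints_Int)
  qed simp
  also have "(rGamma (d + 1))\<^sup>2 * Gamma (d + 1 - d) * Gamma (d + 1 + d) = 2 / d * (Gamma (2 * d) * (rGamma d)\<^sup>2)"
  proof -
    have "Gamma (2 * d + 1) = 2 * d * Gamma (2 * d)"
      using two_d by (intro Gamma_plus1) auto
    moreover have "d + 1 + d = 2 * d + 1" by simp
    ultimately show ?thesis
      unfolding rGamma_plus1[of d, symmetric] using nonzero_d by (simp add: power2_eq_square)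
  qed
  finally have "(\<lambda>n. gamma_quot_residue d (n + Suc l) (Suc l)) \<longlonglongrightarrow>
     d / 2 * ((pochhammer (1 - d) l)\<^sup>2 / (fact l * pochhammer (1 - 2 * d) l) * (2 / d * (Gamma (2 * d) * (rGamma d)\<^sup>2)))"
    unfolding split by (intro tendsto_intros)
  also have "d / 2 * ((pochhammer (1 - d) l)\<^sup>2 / (fact l * pochhammer (1 - 2 * d) l) * (2 / d * (Gamma (2 * d) * (rGamma d)\<^sup>2)))
    = Gamma (2 * d) * (rGamma d)\<^sup>2 * ((pochhammer (1 - d) l)\<^sup>2 / (fact l * pochhammer (1 - 2 * d) l))"
    using nonzero_d by simp
  finally show ?thesis by (rule LIMSEQ_offset)
qed

end

section \<open>The three hypergeometric series as limits\<close>

lemma sums_pole_sum: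
  assumes "\<And>k. 1 \<le> k \<Longrightarrow> k \<le> n \<Longrightarrow> (\<lambda>l. f l (real k - d)) sums g (real k - d)"
    and "\<And>k. 1 \<le> k \<Longrightarrow> k \<le> n \<Longrightarrow> (\<lambda>l. f l (real k + d)) sums g (real k + d)"
  shows "(\<lambda>l. pole_sum d n (f l)) sums pole_sum d n g"
  unfolding pole_sum_def by (intro sums_sum sums_add sums_mult) (use assms in auto)

text \<open>Consecutive terms have ratio \<open>y / (z - Suc l)\<close>, which tends to 0.\<close>

lemma summable_Gamma_diff_nat:
  fixes z y :: real
  assumes "z \<notin> \<int>"
  shows "summable (\<lambda>l. norm (Gamma (z - real l) * y ^ l))"
proof -
  have "eventually (\<lambda>l. 2 * \<bar>y\<bar> \<le> \<bar>z - real (Suc l)\<bar>) sequentially" by real_asymp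
  then obtain N where N: "\<And>l. l \<ge> N \<Longrightarrow> 2 * \<bar>y\<bar> \<le> \<bar>z - real (Suc l)\<bar>"
    by (auto simp: eventually_sequentially)
  show ?thesis
  proof (rule summable_ratio_test[where c = "1 / 2" and N = N])
    fix l assume "l \<ge> N"
    have ni: "z - real (Suc l) \<notin> \<int>"
      using assms by (metis Ints_add Ints_of_nat diff_add_cancel)
    then have "z - real (Suc l) \<noteq> 0" by (metis Ints_0)
    have "z - real (Suc l) \<notin> \<int>\<^sub>\<le>\<^sub>0" using ni nonpos_Ints_Int by blast
    from Gamma_plus1[OF this] have "Gamma (z - real l) = (z - real (Suc l)) * Gamma (z - real (Suc l))"
      by simp
    moreover have "2 * \<bar>y\<bar> * (\<bar>Gamma (z - real (Suc l))\<bar> * \<bar>y\<bar> ^ l)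
        \<le> \<bar>z - real (Suc l)\<bar> * (\<bar>Gamma (z - real (Suc l))\<bar> * \<bar>y\<bar> ^ l)"
      using N[OF \<open>l \<ge> N\<close>] by (intro mult_right_mono) auto
    ultimately show "norm (norm (Gamma (z - real (Suc l)) * y ^ Suc l)) \<le> 1 / 2 * norm (norm (Gamma (z - real l) * y ^ l))"
      by (simp only: abs_idempotent norm_mult real_norm_def power_abs norm_power abs_mult power_Suc) (simp add: mult_ac)
  qed simp
qed

context simple_poles
begin

text \<open>Tannery's theorem applies: the residues converge termwise and are uniformly bounded, and
  the other factors are absolutely summable. The limit is the third series of \<open>h2\<close>;
  \<open>- d\<close> in place of \<open>d\<close> gives the second.\<close>

lemma residue_series_LIMSEQ:
  assumes b: "b + d \<notin> \<int>" and Y: "Y > 0"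
  shows "(\<lambda>n. \<Sum>k=1..n. gamma_quot_residue d n k * (Y powr (real k - d) * Gamma (b - (real k - d))))
    \<longlonglongrightarrow> Gamma (b - 1 + d) * Gamma (2 * d) * (rGamma d)\<^sup>2 * Y powr (1 - d)
        * hyp_2F2 (1 - d) (1 - d) (2 - b - d) (1 - 2 * d) (- Y)"
proof -
  obtain C where C: "C > 0" "\<And>n k. \<bar>gamma_quot_residue d n k\<bar> \<le> C"
    by (rule gamma_quot_residue_bounded[where d = d]) blast
  define g where "g = (\<lambda>l. Y powr (1 - d) * (Gamma (b - 1 + d - real l) * Y ^ l))"
  have g: "Y powr (real (Suc l) - d) * Gamma (b - (real (Suc l) - d)) = g l" for l
  proof -
    have "Y powr (real (Suc l) - d) = Y powr (1 - d) * Y ^ l"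
      using Y by (simp add: powr_realpow[symmetric] powr_add[symmetric] algebra_simps)
    moreover have "b - (real (Suc l) - d) = b - 1 + d - real l" by simp
    ultimately show ?thesis by (simp only: g_def mult_ac)
  qed
  \<comment> \<open>The sum over \<open>k = 1..n\<close> is reindexed by \<open>k = Suc l\<close>
    and padded with zeros to an infinite series.\<close>
  define a where "a = (\<lambda>l n. if l < n then gamma_quot_residue d n (Suc l) * g l else 0)"
  define c where "c = (\<lambda>l. Gamma (2 * d) * (rGamma d)\<^sup>2 * ((pochhammer (1 - d) l)\<^sup>2 / (fact l * pochhammer (1 - 2 * d) l)))"
  have ni: "b - 1 + d \<notin> \<int>"
    using b by (metis Ints_1 Ints_add add.commute add_diff_eq diff_add_cancel)
  have summ: "summable (\<lambda>l. norm (g l))"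
    using summable_mult[OF summable_Gamma_diff_nat[OF ni, of Y], of "Y powr (1 - d)"]
    unfolding g_def by (simp add: abs_mult)
  have T: "summable (\<lambda>l. norm (c l * g l)) \<and> (\<lambda>n. \<Sum>l. a l n) \<longlonglongrightarrow> (\<Sum>l. c l * g l)"
  proof (rule tannerys_theorem[THEN conjunct2])
    show "(\<lambda>n. a l n) \<longlonglongrightarrow> c l * g l" for l
    proof (rule Lim_transform_eventually)
      show "(\<lambda>n. gamma_quot_residue d n (Suc l) * g l) \<longlonglongrightarrow> c l * g l"
        unfolding c_def by (intro tendsto_mult_right gamma_quot_residue_LIMSEQ)
      show "eventually (\<lambda>n. gamma_quot_residue d n (Suc l) * g l = a l n) sequentially"
        using eventually_gt_at_top[of l] by eventually_elim (simp add: a_def)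
    qed
    have "norm (a l n) \<le> C * norm (g l)" for l n
      using C by (auto simp: a_def abs_mult intro: mult_right_mono)
    then show "eventually (\<lambda>(l, n). norm (a l n) \<le> C * norm (g l)) (sequentially \<times>\<^sub>F sequentially)"
      by (intro always_eventually) auto
    show "summable (\<lambda>l. C * norm (g l))" using summ by (rule summable_mult)
  qed simp
  moreover have "(\<Sum>l. a l n) = (\<Sum>k=1..n. gamma_quot_residue d n k * (Y powr (real k - d) * Gamma (b - (real k - d))))" for n
  proof -
    have "(\<Sum>l. a l n) = (\<Sum>l<n. a l n)" by (rule suminf_finite) (auto simp: a_def)
    also have "\<dots> = (\<Sum>l<n. gamma_quot_residue d n (Suc l) * (Y powr (real (Suc l) - d) * Gamma (b - (real (Suc l) - d))))"
      by (intro sum.cong refl) (simp only: g, simp add: a_def)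
    also have "\<dots> = (\<Sum>k=1..n. gamma_quot_residue d n k * (Y powr (real k - d) * Gamma (b - (real k - d))))"
      by (simp only: sum.atLeast1_atMost_eq One_nat_def)
    finally show ?thesis .
  qed
  moreover have "(\<Sum>l. c l * g l) = Gamma (b - 1 + d) * Gamma (2 * d) * (rGamma d)\<^sup>2 * Y powr (1 - d)
        * hyp_2F2 (1 - d) (1 - d) (2 - b - d) (1 - 2 * d) (- Y)" (is "_ = ?K * _")
  proof -
    define h where "h = (\<lambda>l. pochhammer (1 - d) l * pochhammer (1 - d) l / (pochhammer (2 - b - d) l * pochhammer (1 - 2 * d) l)
            * ((- Y) ^ l / fact l))"
    have eq: "c l * g l = ?K * h l" for l
    proof -
      have "1 - (b - 1 + d) = 2 - b - d" by simp
      then have "Gamma (b - 1 + d - real l) = (- 1) ^ l / pochhammer (2 - b - d) l * Gamma (b - 1 + d)"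
        by (simp only: Gamma_diff_nat)
      then show ?thesis
        unfolding c_def g_def h_def by (simp add: power_minus[of Y] power2_eq_square mult_ac)
    qed
    have "(\<Sum>l. ?K * h l) = ?K * (\<Sum>l. h l)"
    proof (cases "?K = 0")
      case False
      have "summable (\<lambda>l. ?K * h l)" using summable_norm_cancel[OF T[THEN conjunct1]] by (simp only: eq)
      then have "summable h" using False by (simp only: summable_cmult_iff) simp
      then show ?thesis by (rule suminf_mult)
    next
      case True
      then show ?thesis by (simp only: mult_zero_left suminf_zero)
    qed
    then show ?thesis unfolding eq hyp_2F2_def h_def .
  qed
  ultimately show ?thesis using T by simp
qed

text \<open>The arguments \<open>- b - l\<close> are the poles of \<open>Gamma (s + b)\<close> in
  the Mellin transform. Termwise limits of \<open>gamma_quot\<close> there yield the pochhammer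
  symbols of the first series.\<close>

lemma gamma_quot_series_LIMSEQ:
  assumes b: "b - d \<notin> \<int>" "b + d \<notin> \<int>"
  shows "(\<lambda>n. \<Sum>l. gamma_quot d n (- b - real l) * (inverse (fact l) * (- Y) ^ l))
    \<longlonglongrightarrow> Gamma (d + 1 - b) * Gamma (1 - b - d) * (rGamma (1 - b))\<^sup>2 * hyp_2F2 b b (b - d) (b + d) (- Y)"
proof -
  obtain C where C: "C > 0" "\<And>n l. \<bar>gamma_quot d n (- b - real l)\<bar> \<le> C"
    by (rule gamma_quot_bounded[where d = d and s = "- b"]) blast
  define w where "w = (\<lambda>l. inverse (fact l) * (- Y) ^ l)"
  define c where "c = (\<lambda>l. (rGamma (- b - real l + 1))\<^sup>2 * Gamma (- b - real l + 1 - d) * Gamma (- b - real l + 1 + d))"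
  have ni: "z - real l \<notin> \<int>" if "z \<notin> \<int>" for z l
    using that by (metis Ints_add Ints_of_nat diff_add_cancel)
  have b': "1 - b - d \<notin> \<int>" "1 - b + d \<notin> \<int>"
    using b Ints_diff[OF Ints_1, of "1 - b - d"] Ints_diff[OF Ints_1, of "1 - b + d"] by auto
  have sw: "summable (\<lambda>l. C * norm (w l))"
  proof -
    have "summable (\<lambda>l. C * (inverse (fact l) * \<bar>Y\<bar> ^ l))"
      by (intro summable_mult summable_exp)
    then show ?thesis by (simp add: w_def abs_mult power_abs)
  qed
  have T: "summable (\<lambda>l. norm (c l * w l)) \<and> (\<lambda>n. \<Sum>l. gamma_quot d n (- b - real l) * w l) \<longlonglongrightarrow> (\<Sum>l. c l * w l)"
  proof (rule tannerys_theorem[THEN conjunct2])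
    show "(\<lambda>n. gamma_quot d n (- b - real l) * w l) \<longlonglongrightarrow> c l * w l" for l
    proof -
      have "- b - real l + 1 - d = (1 - b - d) - real l" "- b - real l + 1 + d = (1 - b + d) - real l" by simp_all
      then have "- b - real l + 1 - d \<notin> \<int>\<^sub>\<le>\<^sub>0" "- b - real l + 1 + d \<notin> \<int>\<^sub>\<le>\<^sub>0"
        using ni[OF b'(1), of l] ni[OF b'(2), of l] by (metis nonpos_Ints_Int)+
      then show ?thesis
        unfolding c_def by (intro tendsto_mult_right gamma_quot_LIMSEQ)
    qed
    have "norm (gamma_quot d n (- b - real l) * w l) \<le> C * norm (w l)" for l n
      using C by (auto simp: abs_mult intro: mult_right_mono)
    then show "eventually (\<lambda>(l, n). norm (gamma_quot d n (- b - real l) * w l) \<le> C * norm (w l)) (sequentially \<times>\<^sub>F sequentially)"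
      by (intro always_eventually) auto
  qed (use sw in auto)
  define K where "K = Gamma (d + 1 - b) * Gamma (1 - b - d) * (rGamma (1 - b))\<^sup>2"
  define h where "h = (\<lambda>l. pochhammer b l * pochhammer b l / (pochhammer (b - d) l * pochhammer (b + d) l)
            * ((- Y) ^ l / fact l))"
  have eq: "c l * w l = K * h l" for l
  proof -
    have 1: "rGamma (- b - real l + 1) = (- 1) ^ l * pochhammer b l * rGamma (1 - b)"
      using rGamma_diff_nat[of "1 - b" l] by (simp add: algebra_simps)
    have 2: "Gamma (- b - real l + 1 - d) = (- 1) ^ l / pochhammer (b + d) l * Gamma (1 - b - d)"
      using Gamma_diff_nat[of "1 - b - d" l] by (simp add: algebra_simps)
    have 3: "Gamma (- b - real l + 1 + d) = (- 1) ^ l / pochhammer (b - d) l * Gamma (d + 1 - b)"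
      using Gamma_diff_nat[of "1 - b + d" l] by (simp add: algebra_simps)
    have s: "((- 1) ^ l * (- 1) ^ l :: real) = 1" by (simp flip: power_add)
    have "c l = ((- 1) ^ l * (- 1) ^ l) * ((- 1) ^ l * (- 1) ^ l) * (K * (pochhammer b l * pochhammer b l / (pochhammer (b - d) l * pochhammer (b + d) l)))"
      unfolding c_def K_def 1 2 3 by (simp add: power2_eq_square mult_ac)
    then show ?thesis unfolding s h_def w_def by (simp add: divide_inverse mult_ac)
  qed
  have "(\<Sum>l. K * h l) = K * (\<Sum>l. h l)"
  \<comment> \<open>\<open>K = 0\<close> does occur, for positive integers \<open>b\<close>, where
    \<open>rGamma (1 - b)\<close> vanishes. Otherwise dividing by \<open>K\<close> gives summability
    of \<open>h\<close>.\<close>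
  proof (cases "K = 0")
    case False
    have "summable (\<lambda>l. K * h l)" using summable_norm_cancel[OF T[THEN conjunct1]] by (simp only: eq)
    then have "summable h" using False by (simp only: summable_cmult_iff) simp
    then show ?thesis by (rule suminf_mult)
  qed simp
  with T show ?thesis unfolding eq by (simp add: K_def h_def hyp_2F2_def w_def)
qed

text \<open>Each \<open>upper_gamma\<close> splits into \<open>Gamma\<close> and a power series.
  These power series recombine with \<open>exp (- Y)\<close>: in the coefficient of
  \<open>(- Y) ^ l\<close> the partial fractions at \<open>s = - b - l\<close> add up to the partial
  product.\<close>

lemma pole_sum_upper_gamma_eq:
  assumes b: "b - d \<notin> \<int>" "b + d \<notin> \<int>" and Y: "Y > 0"
  shows "Y powr b * exp (- Y) + pole_sum d n (\<lambda>a. Y powr a * upper_gamma (b - a) Y)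
    = Y powr b * (\<Sum>l. gamma_quot d n (- b - real l) * (inverse (fact l) * (- Y) ^ l))
      + pole_sum d n (\<lambda>a. Y powr a * Gamma (b - a))"
proof -
  define w where "w = (\<lambda>l. inverse (fact l) * (- Y) ^ l)"
  have *: "(\<lambda>l. 1 / (fact l * (z + real l)) * (- Y) ^ l) sums lower_gamma_series z Y" for z
    unfolding lower_gamma_series_def by (rule summable_sums[OF summable_lower_gamma_series])
  have "(\<lambda>l. pole_sum d n (\<lambda>a. 1 / (fact l * (b - a + real l)) * (- Y) ^ l))
     sums pole_sum d n (\<lambda>a. lower_gamma_series (b - a) Y)"
    by (intro sums_pole_sum *)
  moreover have "w sums exp (- Y)"
    unfolding w_def using exp_converges[of "- Y"] by (simp add: divide_inverse mult.commute)
  ultimately have "(\<lambda>l. w l - pole_sum d n (\<lambda>a. 1 / (fact l * (b - a + real l)) * (- Y) ^ l))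
     sums (exp (- Y) - pole_sum d n (\<lambda>a. lower_gamma_series (b - a) Y))"
    by (intro sums_diff)
  moreover have "w l - pole_sum d n (\<lambda>a. 1 / (fact l * (b - a + real l)) * (- Y) ^ l)
      = gamma_quot d n (- b - real l) * w l" for l
  proof -
    have "1 / (fact l * (b - a + real l)) * (- Y) ^ l = (- w l) * (1 / (- b - real l + a))" for a
    proof -
      have "- b - real l + a = - (b - a + real l)" by simp
      then show ?thesis by (simp only: minus_divide_right[symmetric]) (simp add: w_def divide_inverse mult_ac)
    qed
    then have "pole_sum d n (\<lambda>a. 1 / (fact l * (b - a + real l)) * (- Y) ^ l)
        = (- w l) * pole_sum d n (\<lambda>a. 1 / (- b - real l + a))"
      by (simp only: pole_sum_cmult)
    moreover have "gamma_quot d n (- b - real l) = 1 + pole_sum d n (\<lambda>a. 1 / (- b - real l + a))"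
    proof (rule gamma_quot_partial_fractions)
      fix k
      have "b - d \<noteq> real k - real l" "b + d \<noteq> real k - real l"
        using b by (metis Ints_diff Ints_of_nat)+
      then show "- b - real l + real k \<noteq> d \<and> - b - real l + real k \<noteq> - d" by linarith
    qed
    ultimately show ?thesis by (simp add: algebra_simps)
  qed
  ultimately have "exp (- Y) - pole_sum d n (\<lambda>a. lower_gamma_series (b - a) Y)
      = (\<Sum>l. gamma_quot d n (- b - real l) * w l)"
    by (simp add: sums_iff)
  moreover have "pole_sum d n (\<lambda>a. Y powr a * upper_gamma (b - a) Y)
     = pole_sum d n (\<lambda>a. Y powr a * Gamma (b - a) - Y powr b * lower_gamma_series (b - a) Y)"
    using Y by (intro arg_cong[of _ _ "pole_sum d n"])
      (simp add: fun_eq_iff upper_gamma_def right_diff_distrib powr_diff)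
  ultimately show ?thesis
    unfolding pole_sum_diff pole_sum_cmult w_def by (simp add: algebra_simps)
qed

end

text \<open>The expression in braces from \<open>h2\<close> as a function of \<open>Y\<close>, so
  that its asymptotics can be taken at infinity.\<close>

definition second_order_kernel :: "real \<Rightarrow> real \<Rightarrow> real \<Rightarrow> real" where
  "second_order_kernel d b Y =
     Gamma (d + 1 - b) * Gamma (1 - b - d) * (rGamma (1 - b))\<^sup>2
       * Y powr b * hyp_2F2 b b (b - d) (b + d) (- Y)
     + Gamma (b - 1 - d) * Gamma (- 2 * d) * (rGamma (- d))\<^sup>2
       * Y powr (1 + d) * hyp_2F2 (1 + d) (1 + d) (2 - b + d) (1 + 2 * d) (- Y)
     + Gamma (b - 1 + d) * Gamma (2 * d) * (rGamma d)\<^sup>2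
       * Y powr (1 - d) * hyp_2F2 (1 - d) (1 - d) (2 - b - d) (1 - 2 * d) (- Y)"

section \<open>Bounds and asymptotics of the limit\<close>

context simple_poles
begin

lemma second_order_kernel_LIMSEQ:
  assumes b: "b - d \<notin> \<int>" "b + d \<notin> \<int>" and Y: "Y > 0"
  shows "(\<lambda>n. Y powr b * exp (- Y) + pole_sum d n (\<lambda>a. Y powr a * upper_gamma (b - a) Y))
    \<longlonglongrightarrow> second_order_kernel d b Y"
proof -
  \<comment> \<open>Writing \<open>real k - - d\<close> makes the second sum an instance of
    \<open>residue_series_LIMSEQ\<close> at \<open>- d\<close>.\<close>
  have "pole_sum d n (\<lambda>a. Y powr a * Gamma (b - a)) =
     (\<Sum>k=1..n. gamma_quot_residue d n k * (Y powr (real k - d) * Gamma (b - (real k - d)))) +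
     (\<Sum>k=1..n. gamma_quot_residue (- d) n k * (Y powr (real k - - d) * Gamma (b - (real k - - d))))" for n
    by (simp add: pole_sum_def sum.distrib)
  then show ?thesis
    unfolding pole_sum_upper_gamma_eq[OF b Y]
    using tendsto_add[OF tendsto_mult_left[OF gamma_quot_series_LIMSEQ[OF b, of Y], of "Y powr b"]
       tendsto_add[OF residue_series_LIMSEQ[OF b(2) Y]
         simple_poles.residue_series_LIMSEQ[OF minus_simple_poles, of b Y]]] b Y
    by (simp add: second_order_kernel_def mult_ac add_ac)
qed

text \<open>The bounds for finite \<open>n\<close> have constants independent of \<open>n\<close>,
  so they pass to the limit.\<close>

lemma second_order_kernel_bounds:
  assumes "d > 0" "Y > 0" "Y - b > d" "b - d \<notin> \<int>" "b + d \<notin> \<int>"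
  defines "H \<equiv> Y powr b * exp (- Y)"
  shows "H \<le> second_order_kernel d b Y" "second_order_kernel d b Y \<le> exp (d\<^sup>2 / (Y - b - d)) * H"
proof -
  note lim = second_order_kernel_LIMSEQ[OF assms(4,5,2)]
  show "H \<le> second_order_kernel d b Y"
    by (rule tendsto_lowerbound[OF lim])
       (use pole_sum_upper_gamma_bounds(1)[OF assms(1-5)] in \<open>auto simp: H_def\<close>)
  show "second_order_kernel d b Y \<le> exp (d\<^sup>2 / (Y - b - d)) * H"
  proof (rule tendsto_upperbound[OF lim])
    have "H + pole_sum d n (\<lambda>a. Y powr a * upper_gamma (b - a) Y) \<le> exp (d\<^sup>2 / (Y - b - d)) * H" for n
    proof -
      have "H + pole_sum d n (\<lambda>a. Y powr a * upper_gamma (b - a) Y) \<le> gamma_quot d n (Y - b) * H"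
        using pole_sum_upper_gamma_bounds(2)[OF assms(1-5), of n] by (simp add: H_def algebra_simps)
      also have "\<dots> \<le> exp (d\<^sup>2 / (Y - b - d)) * H"
        using gamma_quot_le[OF assms(1,3), of n] by (intro mult_right_mono) (auto simp: H_def)
      finally show ?thesis .
    qed
    then show "eventually (\<lambda>n. Y powr b * exp (- Y) + pole_sum d n (\<lambda>a. Y powr a * upper_gamma (b - a) Y)
        \<le> exp (d\<^sup>2 / (Y - b - d)) * H) sequentially"
      unfolding H_def by (rule always_eventually[OF allI])
  qed simp
qed

lemma second_order_kernel_asymp_equiv:
  assumes "d > 0" "b - d \<notin> \<int>" "b + d \<notin> \<int>"
  shows "second_order_kernel d b \<sim>[at_top] (\<lambda>Y. Y powr b * exp (- Y))"
proof (rule asymp_equivI', rule tendsto_sandwich)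
  have ev: "eventually (\<lambda>Y. Y > 0 \<and> Y - b > d) at_top"
    using eventually_gt_at_top[of 0] eventually_gt_at_top[of "b + d"] by eventually_elim auto
  show "eventually (\<lambda>Y. 1 \<le> second_order_kernel d b Y / (Y powr b * exp (- Y))) at_top"
    using ev by eventually_elim (use second_order_kernel_bounds(1)[OF assms(1) _ _ assms(2,3)] in \<open>simp add: le_divide_eq\<close>)
  show "eventually (\<lambda>Y. second_order_kernel d b Y / (Y powr b * exp (- Y)) \<le> exp (d\<^sup>2 / (Y - b - d))) at_top"
    using ev by eventually_elim (use second_order_kernel_bounds(2)[OF assms(1) _ _ assms(2,3)] in \<open>simp add: divide_le_eq\<close>)
  show "((\<lambda>Y. exp (d\<^sup>2 / (Y - b - d))) \<longlongrightarrow> 1) at_top" by real_asymp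
qed simp

end

theorem corollary5p2:
  fixes \<alpha> \<gamma> \<delta> \<beta> :: real
  assumes "0 < \<alpha>" and "\<alpha> < 1" and "0 < \<gamma>"
    and "\<delta> = \<alpha> powr (1/2) * \<gamma> powr (-1/2) / (1 - \<alpha>)"
    and "\<beta> = 1 / (1 - \<alpha>)"
    and "2 * \<delta> \<notin> \<int>" and "\<beta> - \<delta> \<notin> \<int>" and "\<beta> + \<delta> \<notin> \<int>"
  shows "h2 \<alpha> \<gamma> \<delta> \<beta> \<sim>[at_right 0]
    (\<lambda>x. \<gamma> * (1 - \<alpha>) powr (- \<gamma> / (1 - \<alpha>))
          / (Gamma (1 / (1 - \<alpha>))
             * Gamma (1 + \<alpha> powr (1/2) * \<gamma> powr (-1/2) / (1 - \<alpha>))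
             * Gamma (1 - \<alpha> powr (1/2) * \<gamma> powr (-1/2) / (1 - \<alpha>)))
          * x powr (- 1 - \<gamma> / (1 - \<alpha>))
          * exp (- ((1 - \<alpha>) powr (- \<gamma>) * x powr (- \<gamma>))))"
proof -
  interpret simple_poles \<delta> by unfold_locales fact
  define Y where "Y = (\<lambda>x. ((1 - \<alpha>) * x) powr (- \<gamma>))"
  define c where "c = (\<lambda>x. \<gamma> * inverse x / (Gamma \<beta> * Gamma (1 + \<delta>) * Gamma (1 - \<delta>)))"
  have "\<delta> > 0" using assms(1-3) by (simp add: assms(4))
  have "1 - \<alpha> > 0" using assms(2) by simp
  then have "filterlim Y at_top (at_right 0)"
    unfolding Y_def using assms(3) by real_asymp
  \<comment> \<open>As \<open>x\<close> tends to 0 from the right, \<open>Y x\<close> tends to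
    infinity, so the equivalence may be composed with \<open>Y\<close> and multiplied by the common
    prefactor.\<close>
  from asymp_equiv_compose'[OF second_order_kernel_asymp_equiv[OF \<open>\<delta> > 0\<close> assms(7,8)] this]
  have "(\<lambda>x. c x * second_order_kernel \<delta> \<beta> (Y x)) \<sim>[at_right 0] (\<lambda>x. c x * (Y x powr \<beta> * exp (- Y x)))"
    by (intro asymp_equiv_mult asymp_equiv_refl)
  also have "(\<lambda>x. c x * second_order_kernel \<delta> \<beta> (Y x)) = h2 \<alpha> \<gamma> \<delta> \<beta>"
    by (simp add: fun_eq_iff h2_def second_order_kernel_def c_def Y_def Let_def)
  finally show ?thesis
  proof (rule asymp_equiv_transfer)
    show "eventually (\<lambda>x. c x * (Y x powr \<beta> * exp (- Y x)) =
      \<gamma> * (1 - \<alpha>) powr (- \<gamma> / (1 - \<alpha>))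
          / (Gamma (1 / (1 - \<alpha>))
             * Gamma (1 + \<alpha> powr (1/2) * \<gamma> powr (-1/2) / (1 - \<alpha>))
             * Gamma (1 - \<alpha> powr (1/2) * \<gamma> powr (-1/2) / (1 - \<alpha>)))
          * x powr (- 1 - \<gamma> / (1 - \<alpha>))
          * exp (- ((1 - \<alpha>) powr (- \<gamma>) * x powr (- \<gamma>)))) (at_right 0)"
      using eventually_at_right_less[of 0]
    proof eventually_elim
      case (elim x)
      have Y: "Y x = (1 - \<alpha>) powr (- \<gamma>) * x powr (- \<gamma>)"
        using elim \<open>1 - \<alpha> > 0\<close> by (simp add: Y_def powr_mult)
      have "Y x powr \<beta> = (1 - \<alpha>) powr (- \<gamma> / (1 - \<alpha>)) * x powr (- \<gamma> / (1 - \<alpha>))"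
        using elim \<open>1 - \<alpha> > 0\<close> unfolding Y by (simp add: powr_mult powr_powr assms(5))
      moreover have "x powr (- 1 - \<gamma> / (1 - \<alpha>)) = inverse x * x powr (- \<gamma> / (1 - \<alpha>))"
        using elim by (simp add: powr_diff powr_minus divide_inverse)
      ultimately show ?case
        unfolding c_def Y assms(4,5)[symmetric] by simp
    qed
  qed auto
qed

end
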